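(* Let $\mathbf{H}$ be an infinite Hermitian random matrix such that for any permutation $\tau$ of $\mathbb{N}$ that fixes all but finitely many elements, $\mathsf{Law}(\mathbf{H})=\mathsf{Law}(\mathbf{P}_\tau\mathbf{H}\mathbf{P}_\tau^* )$, where $\mathbf{P}_\tau$ is the permutation matrix that corresponds to $\tau$. For each $N\in\mathbb{N}$ consider the $N\times N$ top-left corner $\mathbf{H}_N=[\mathbf{H}_{ij}]_{i,j=1,\ldots,N}$ of $\mathbf{H}$ and its rescaled (reverse) characteristic polynomial $$\mathfrak{p}_N(z)=\det\left(\mathbf{I}-\frac zN\mathbf{H}_N\right)=1+\sum_{k=1}^N\mathsf{a}_N^{(k)}(\mathbf{H})z^k.$$ Suppose there exist $M\in\mathbb{N}$ and $p\in[1,\infty)$ such that $\mathbb{E}\left[|\det(\mathbf{H}_k)|^p\right]<\infty$ for $k=1,\ldots,M$. Then: (1) There exist random variables $\{\mathsf{a}_k(\mathbf{H})\}_{k=1}^M$ such that, for $k=1,\ldots,M$, $\mathsf{a}_N^{(k)}(\mathbf{H})\to\mathsf{a}_k(\mathbf{H})$ as $N\to\infty$, in $L^p$ and almost surely with respect to $\mathsf{Law}(\mathbf{H})$. (2) Furthermore, if $r_1,\ldots,r_M\in\mathbb{R}_{\ge0}$ are such that $\sum_jr_j=p$, then $$\mathbb{E}\left[\prod_{k=1}^M\left|\mathsf{a}_N^{(k)}(\mathbf{H})\right|^{r_k}\right]\xrightarrow[N\to\infty]{}\mathbb{E}\left[\prod_{k=1}^M\left|\mathsf{a}_k(\mathbf{H})\right|^{r_k}\right].$$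 (3) Moreover, if $r_1,\ldots,r_l\in\mathbb{N}$, $M\ge k_1>\cdots>k_l\ge1$, and $L=\sum_jr_jk_j$, then $$\mathbb{E}\left[\prod_{j=1}^l\left(\mathsf{a}_{k_j}(\mathbf{H})\right)^{r_j}\right]=\frac{(k_1!)^{r_1}\cdots(k_l!)^{r_l}}{L!}\sum_{m=k_1}^L(-1)^{m+L}\binom Lm\,\mathbb{E}\left[\prod_{j=1}^l\left(\mathsf{a}_m^{(k_j)}(\mathbf{H})\right)^{r_j}\right].$$
   Context: An infinite Hermitian random matrix is a random element $\mathbf{H}=[\mathbf{H}_{ij}]_{i,j\in\mathbb{N}}$ of the space $\mathbb{H}(\infty)$ of infinite complex Hermitian matrices, i.e. the projective limit of the spaces $\mathbb{H}(N)$ of $N\times N$ Hermitian matrices under the maps sending an $(N+1)\times(N+1)$ matrix to its top-left $N\times N$ corner, with the Borel $\sigma$-algebra of the projective limit topology. $\mathsf{Law}(\mathfrak X)$ denotes the law of the random variable $\mathfrak X$, and $\mathbb{E}$ is expectation with respect to $\mathsf{Law}(\mathbf{H})$.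
   Formalization: In (3) the printed formula fails (H = identity, l=1, k_1=2, r_1=1: 1/2 vs 1/4); the factor (k_1!)^{r_1}...(k_l!)^{r_l} is dropped and m^L is inserted in the sum. (3) is claimed when the right-hand expectations exist, which is proved if r_1+...+r_l ≤ p. *)

theory Defs
  imports "HOL-Probability.Probability" "Jordan_Normal_Form.Char_Poly"
begin

hide_const (open) Determinants.det

text \<open>
  Infinite matrices are functions \<open>nat \<Rightarrow> nat \<Rightarrow> complex\<close>, with rows and columns indexed from 0, so
  that the top-left \<open>N \<times> N\<close> corner has the indices \<open>i, j < N\<close>. The topology of this function type is
  the product topology. On the Hermitian matrices it induces the coarsest topology for which all
  corner maps are continuous, that is, the projective limit topology.
\<close>

definition herm_inf_set :: "(nat \<Rightarrow> nat \<Rightarrow> complex) set" where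
  "herm_inf_set = {H. \<forall>i j. H i j = cnj (H j i)}"

definition herm_inf :: "(nat \<Rightarrow> nat \<Rightarrow> complex) measure" where
  "herm_inf = restrict_space borel herm_inf_set"

definition law :: "'w measure \<Rightarrow> ('w \<Rightarrow> nat \<Rightarrow> nat \<Rightarrow> complex) \<Rightarrow> (nat \<Rightarrow> nat \<Rightarrow> complex) measure" where
  "law P X = distr P herm_inf X"

definition corner :: "nat \<Rightarrow> (nat \<Rightarrow> nat \<Rightarrow> complex) \<Rightarrow> complex mat" where
  "corner N H = mat N N (\<lambda>(i, j). H i j)"

text \<open>
  In the products below every sum has at most one nonzero term, because each row and each column of
  a permutation matrix has exactly one nonzero entry.
\<close>

definition imat_mult ::
  "(nat \<Rightarrow> nat \<Rightarrow> complex) \<Rightarrow> (nat \<Rightarrow> nat \<Rightarrow> complex) \<Rightarrow> nat \<Rightarrow> nat \<Rightarrow> complex" where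
  "imat_mult A B = (\<lambda>i j. \<Sum>\<^sub>\<infinity>k. A i k * B k j)"

definition imat_adjoint :: "(nat \<Rightarrow> nat \<Rightarrow> complex) \<Rightarrow> nat \<Rightarrow> nat \<Rightarrow> complex" where
  "imat_adjoint A = (\<lambda>i j. cnj (A j i))"

definition perm_mat :: "(nat \<Rightarrow> nat) \<Rightarrow> nat \<Rightarrow> nat \<Rightarrow> complex" where
  "perm_mat \<tau> = (\<lambda>i j. if i = \<tau> j then 1 else 0)"

definition perm_conj :: "(nat \<Rightarrow> nat) \<Rightarrow> (nat \<Rightarrow> nat \<Rightarrow> complex) \<Rightarrow> nat \<Rightarrow> nat \<Rightarrow> complex" where
  "perm_conj \<tau> H = imat_mult (imat_mult (perm_mat \<tau>) H) (imat_adjoint (perm_mat \<tau>))"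

lemma infsum_single_term:
  fixes f :: "nat \<Rightarrow> complex"
  assumes "\<And>k. k \<noteq> c \<Longrightarrow> f k = 0"
  shows "(\<Sum>\<^sub>\<infinity>k. f k) = f c"
proof -
  have "(\<Sum>\<^sub>\<infinity>k. f k) = (\<Sum>\<^sub>\<infinity>k\<in>{c}. f k)"
    by (rule infsum_cong_neutral) (use assms in auto)
  then show ?thesis by simp
qed

lemma perm_conj_apply:
  assumes "bij \<tau>"
  shows "perm_conj \<tau> H (\<tau> i) (\<tau> j) = H i j"
proof -
  have inj: "\<tau> x = \<tau> y \<longleftrightarrow> x = y" for x y
    using assms by (auto simp: bij_def inj_eq)
  have left: "imat_mult (perm_mat \<tau>) H (\<tau> i) l = H i l" for l
  proof -
    have "imat_mult (perm_mat \<tau>) H (\<tau> i) l = perm_mat \<tau> (\<tau> i) i * H i l"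
      unfolding imat_mult_def by (rule infsum_single_term) (auto simp: perm_mat_def inj)
    then show ?thesis by (simp add: perm_mat_def)
  qed
  have "perm_conj \<tau> H (\<tau> i) (\<tau> j) =
      (\<Sum>\<^sub>\<infinity>l. imat_mult (perm_mat \<tau>) H (\<tau> i) l * imat_adjoint (perm_mat \<tau>) l (\<tau> j))"
    by (simp add: perm_conj_def imat_mult_def[of "imat_mult (perm_mat \<tau>) H"])
  also have "\<dots> = imat_mult (perm_mat \<tau>) H (\<tau> i) j * imat_adjoint (perm_mat \<tau>) j (\<tau> j)"
    by (rule infsum_single_term) (auto simp: imat_adjoint_def perm_mat_def inj)
  finally show ?thesis unfolding left by (simp add: imat_adjoint_def perm_mat_def)
qed

lemma perm_conj_eq:
  assumes "bij \<tau>"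
  shows "perm_conj \<tau> H = (\<lambda>i j. H (inv_into UNIV \<tau> i) (inv_into UNIV \<tau> j))"
proof (intro ext)
  fix i j
  have "\<tau> (inv_into UNIV \<tau> x) = x" for x
    using assms by (simp add: bij_is_surj surj_f_inv_f)
  then show "perm_conj \<tau> H i j = H (inv_into UNIV \<tau> i) (inv_into UNIV \<tau> j)"
    using perm_conj_apply[OF assms, of H "inv_into UNIV \<tau> i" "inv_into UNIV \<tau> j"] by simp
qed

lemma measurable_perm_conj:
  assumes "bij \<tau>"
  shows "perm_conj \<tau> \<in> herm_inf \<rightarrow>\<^sub>M herm_inf"
proof -
  have "continuous_on UNIV (\<lambda>H :: nat \<Rightarrow> nat \<Rightarrow> complex. \<lambda>i j. H (inv_into UNIV \<tau> i) (inv_into UNIV \<tau> j))"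
  proof (intro continuous_on_coordinatewise_then_product)
    fix i j
    have "continuous_on UNIV (\<lambda>H :: nat \<Rightarrow> nat \<Rightarrow> complex. H (inv_into UNIV \<tau> i))"
      by (rule continuous_on_product_coordinates)
    then show "continuous_on UNIV (\<lambda>H :: nat \<Rightarrow> nat \<Rightarrow> complex. H (inv_into UNIV \<tau> i) (inv_into UNIV \<tau> j))"
      by (rule continuous_on_product_then_coordinatewise)
  qed
  then have "(\<lambda>H. \<lambda>i j. H (inv_into UNIV \<tau> i) (inv_into UNIV \<tau> j)) \<in>
      (borel :: (nat \<Rightarrow> nat \<Rightarrow> complex) measure) \<rightarrow>\<^sub>M borel"
    by (rule borel_measurable_continuous_onI)
  then show ?thesis
    unfolding herm_inf_def perm_conj_eq[OF assms, abs_def]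
    by (rule measurable_restrict_space3) (unfold herm_inf_set_def, blast)
qed

text \<open>
  \<open>rev_char_poly N H\<close> is \<open>det (I - (z / N) H\<^sub>N)\<close> as a polynomial in \<open>z\<close>: the determinant is taken over
  the polynomial ring. It agrees with the complex determinant at every \<open>z\<close>
  (\<open>poly_rev_char_poly\<close>), and \<open>rev_char_poly_expansion\<close> identifies \<open>rcoeff N k\<close> as the
  coefficient of \<open>z ^ k\<close>. So \<open>of_nat N ^ k * rcoeff N k H\<close> is, up to the sign \<open>(- 1) ^ k\<close>, the sum of
  the principal \<open>k\<close>-minors of \<open>H\<^sub>N\<close>. The binomial inversion that gives the moments of the limiting
  coefficients applies to these unrescaled sums; hence its \<open>m\<close>-th term carries the factor \<open>m ^ L\<close>.
\<close>

definition rev_char_poly :: "nat \<Rightarrow> (nat \<Rightarrow> nat \<Rightarrow> complex) \<Rightarrow> complex poly" where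
  "rev_char_poly N H =
     det (1\<^sub>m N - monom (1 / of_nat N) 1 \<cdot>\<^sub>m map_mat (\<lambda>c. [:c:]) (corner N H))"

definition rcoeff :: "nat \<Rightarrow> nat \<Rightarrow> (nat \<Rightarrow> nat \<Rightarrow> complex) \<Rightarrow> complex" where
  "rcoeff N k H = coeff (rev_char_poly N H) k"

lemma poly_rev_char_poly:
  "poly (rev_char_poly N H) z = det (1\<^sub>m N - (z / of_nat N) \<cdot>\<^sub>m corner N H)"
  unfolding rev_char_poly_def
  by (rule poly_det_cong[of _ N]) (auto simp: corner_def poly_monom one_mat_def)

lemma poly_as_sum_le:
  fixes q :: "complex poly"
  assumes "degree q \<le> n"
  shows "poly q z = (\<Sum>k\<le>n. coeff q k * z ^ k)"
  unfolding poly_altdef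
  by (rule sum.mono_neutral_left) (use assms in \<open>auto simp: coeff_eq_0\<close>)

lemma degree_rev_char_poly: "degree (rev_char_poly N H) \<le> N"
proof -
  let ?A = "1\<^sub>m N - monom (1 / of_nat N) 1 \<cdot>\<^sub>m map_mat (\<lambda>c. [:c:]) (corner N H)"
  have A: "?A \<in> carrier_mat N N" by (auto simp: corner_def)
  have "degree (det ?A) \<le> N"
    unfolding det_def'[OF A]
  proof (rule degree_sum_le)
    show "finite {q. q permutes {0..<N}}" by (simp add: finite_permutations)
    fix q assume "q \<in> {q. q permutes {0..<N}}"
    then have q: "q permutes {0..<N}" by simp
    have "degree (\<Prod>i = 0..<N. ?A $$ (i, q i)) \<le> (\<Sum>i = 0..<N. degree (?A $$ (i, q i)))"
      using degree_prod_sum_le[of "{0..<N}" "\<lambda>i. ?A $$ (i, q i)"] by (simp add: o_def)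
    also have "\<dots> \<le> (\<Sum>i = 0..<N. 1)"
    proof (rule sum_mono)
      fix i assume "i \<in> {0..<N}"
      then have i: "i < N" and qi: "q i < N" using permutes_in_image[OF q] by auto
      have "?A $$ (i, q i) =
          (if i = q i then 1 else 0) - monom (1 / of_nat N) 1 * [:H i (q i):]"
        using i qi by (simp add: corner_def)
      also have "degree \<dots> \<le> 1"
        by (rule degree_diff_le) (auto intro: order.trans[OF degree_mult_le] simp: degree_monom_le
              intro!: order.trans[OF degree_mult_le] simp: degree_monom_eq split: if_splits)
      finally show "degree (?A $$ (i, q i)) \<le> 1" .
    qed
    finally have "degree (\<Prod>i = 0..<N. ?A $$ (i, q i)) \<le> N" by simp
    then show "degree (signof q * (\<Prod>i = 0..<N. ?A $$ (i, q i))) \<le> N"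
      by (auto simp: sign_def)
  qed
  then show ?thesis by (simp add: rev_char_poly_def)
qed

lemma rev_char_poly_expansion:
  "det (1\<^sub>m N - (z / of_nat N) \<cdot>\<^sub>m corner N H) = 1 + (\<Sum>k = 1..N. rcoeff N k H * z ^ k)"
proof -
  have "rcoeff N 0 H = poly (rev_char_poly N H) 0"
    by (simp add: rcoeff_def poly_0_coeff_0)
  also have "\<dots> = det (1\<^sub>m N :: complex mat)"
    unfolding poly_rev_char_poly
    by (rule arg_cong[of _ _ det]) (auto simp: corner_def)
  finally have 0: "rcoeff N 0 H = 1" by simp
  have "poly (rev_char_poly N H) z = (\<Sum>k\<le>N. rcoeff N k H * z ^ k)"
    unfolding rcoeff_def by (rule poly_as_sum_le[OF degree_rev_char_poly])
  also have "\<dots> = 1 + (\<Sum>k = 1..N. rcoeff N k H * z ^ k)"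
    by (simp add: atMost_atLeast0 sum.atLeast_Suc_atMost 0)
  finally show ?thesis by (simp add: poly_rev_char_poly)
qed

definition Lp_fun :: "'a measure \<Rightarrow> real \<Rightarrow> ('a \<Rightarrow> complex) \<Rightarrow> bool" where
  "Lp_fun \<mu> p f \<longleftrightarrow> f \<in> borel_measurable \<mu> \<and> integrable \<mu> (\<lambda>x. cmod (f x) powr p)"

definition Lp_norm :: "'a measure \<Rightarrow> real \<Rightarrow> ('a \<Rightarrow> complex) \<Rightarrow> real" where
  "Lp_norm \<mu> p f = (\<integral>x. cmod (f x) powr p \<partial>\<mu>) powr (1 / p)"

definition tendsto_Lp ::
  "'a measure \<Rightarrow> real \<Rightarrow> (nat \<Rightarrow> 'a \<Rightarrow> complex) \<Rightarrow> ('a \<Rightarrow> complex) \<Rightarrow> bool" where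
  "tendsto_Lp \<mu> p f g \<longleftrightarrow>
     (\<forall>n. Lp_fun \<mu> p (f n)) \<and> Lp_fun \<mu> p g \<and> (\<lambda>n. Lp_norm \<mu> p (\<lambda>x. f n x - g x)) \<longlonglongrightarrow> 0"

text \<open>
  The library has \<open>0 powr 0 = 0\<close>. In a product of powers with nonnegative exponents a factor with
  exponent 0 must be 1, also when its base vanishes.
\<close>

definition rpow :: "real \<Rightarrow> real \<Rightarrow> real" where
  "rpow x r = (if r = 0 then 1 else x powr r)"

end

theory Submission
  imports Defs
begin

text \<open>
  Up to the factor \<open>(- 1 / N) ^ k\<close> the \<open>k\<close>-th coefficient is the sum of the principal \<open>k\<close>-minors of
  the corner (\<open>rcoeff_eq_minor_sum\<close>). All these minors arise from the leading one by relabelling the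
  indices, so the sum is \<open>N choose k\<close> times the average of \<open>det (corner k H)\<close> over the permutations
  of the first \<open>N\<close> indices (\<open>sum_layer_eq_avg\<close>), and \<open>(N choose k) / N ^ k\<close> tends to \<open>1 / fact k\<close>.

  Under an exchangeable law, the average of \<open>f\<close> over the permutations of the first \<open>n\<close> indices is the
  conditional expectation of \<open>f\<close> given the events that these permutations preserve. As \<open>n\<close> grows there
  are fewer such events: the averages form a reverse martingale. For bounded \<open>f\<close> its differences are
  orthogonal, which gives the Cauchy property in mean square; truncation extends it to integrable \<open>f\<close>
  in mean; and Doob's maximal inequality, applied to the differences of two averages, turns it into
  almost sure convergence (\<open>avg_converges\<close>).

  For convergence in \<open>L\<^sup>p\<close>, convexity bounds the \<open>p\<close>-th power of an average of \<open>f\<close> by the average of the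
  \<open>p\<close>-th powers. These majorants again converge almost surely and all have the same integral as their
  limit, so dominated convergence with varying majorants applies (\<open>generalized_dominated_convergence\<close>).
  A product of powers with total exponent \<open>p\<close> is bounded by the sum of the \<open>p\<close>-th powers, so the same
  majorants serve for the mixed absolute moments.

  For the joint moments, regard the product of the minor sums as a function \<open>F\<close> of the index set. A sum
  over the \<open>k\<close>-subsets is a set function of degree \<open>k\<close>, and degrees add under multiplication; so \<open>F S\<close>
  is the sum of the Moebius transform of \<open>F\<close> over the subsets of \<open>S\<close> with at most \<open>L\<close> elements. By
  symmetry \<open>F {..<N}\<close> is then a combination of averages whose coefficients are the numbers
  \<open>N choose s\<close> with \<open>s \<le> L\<close>, and after division by \<open>N ^ L\<close> only \<open>s = L\<close> survives. The expectation of
  the limit is therefore \<open>1 / fact L\<close> times that of the Moebius transform at an \<open>L\<close>-element set, which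
  exchangeability turns into the alternating sum over \<open>m\<close> in the moment formula
  (\<open>polynomial_statistic_converges\<close>).
\<close>

section \<open>Dominated convergence with convergent majorants\<close>

text \<open>
  The norms \<open>norm (F n x - f x)\<close> exceed \<open>G n x - g x\<close> by at most \<open>2 * g x\<close>. So the ordinary dominated
  convergence theorem disposes of the positive part of the excess, and what is left, \<open>G n - g\<close>, has
  integral tending to 0 by assumption.
\<close>
lemma generalized_dominated_convergence:
  fixes f :: "'a \<Rightarrow> 'b::{banach, second_countable_topology}" and g :: "'a \<Rightarrow> real"
  assumes [measurable]: "\<And>n. F n \<in> borel_measurable M" "f \<in> borel_measurable M"
    and G [measurable]: "\<And>n. integrable M (G n)" and g [measurable]: "integrable M g"
    and F_lim: "AE x in M. (\<lambda>n. F n x) \<longlonglongrightarrow> f x"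
    and G_lim: "AE x in M. (\<lambda>n. G n x) \<longlonglongrightarrow> g x"
    and bound: "\<And>n. AE x in M. norm (F n x) \<le> G n x"
    and int_lim: "(\<lambda>n. \<integral>x. G n x \<partial>M) \<longlonglongrightarrow> (\<integral>x. g x \<partial>M)"
  shows "integrable M f"
    and "\<And>n. integrable M (F n)"
    and "(\<lambda>n. \<integral>x. F n x \<partial>M) \<longlonglongrightarrow> (\<integral>x. f x \<partial>M)"
proof -
  have bound_all: "AE x in M. \<forall>n. norm (F n x) \<le> G n x"
    using bound by (simp add: AE_all_countable)
  have f_bound: "AE x in M. norm (f x) \<le> g x"
    using F_lim G_lim bound_all
  proof eventually_elim
    case (elim x)
    then show ?case
      by (intro LIMSEQ_le[OF tendsto_norm[OF elim(1)] elim(2)]) auto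
  qed
  show int_f: "integrable M f"
    by (rule Bochner_Integration.integrable_bound[OF g]) (use f_bound in auto)
  show int_F: "integrable M (F n)" for n
    by (rule Bochner_Integration.integrable_bound[OF G[of n]]) (use bound[of n] in auto)
    \<comment> \<open>The excess is dominated by \<open>2 * g\<close> and tends to 0.\<close>
define h where "h = (\<lambda>n x. max 0 (norm (F n x - f x) - (G n x - g x)))"
  have "(\<lambda>n. \<integral>x. h n x \<partial>M) \<longlonglongrightarrow> (\<integral>x. 0 \<partial>M)"
  proof (rule integral_dominated_convergence[where w = "\<lambda>x. 2 * g x"])
    show "(\<lambda>x. 0) \<in> borel_measurable M" by simp
    show "h n \<in> borel_measurable M" for n unfolding h_def using G g by measurable
    show "integrable M (\<lambda>x. 2 * g x)" using g by simp
    show "AE x in M. (\<lambda>n. h n x) \<longlonglongrightarrow> 0"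
      using F_lim G_lim
    proof eventually_elim
      case (elim x)
      have "(\<lambda>n. h n x) \<longlonglongrightarrow> max 0 (norm (f x - f x) - (g x - g x))"
        unfolding h_def by (intro tendsto_intros elim)
      then show ?case by simp
    qed
    show "AE x in M. norm (h n x) \<le> 2 * g x" for n
      using bound_all f_bound
    proof eventually_elim
      case (elim x)
      have "norm (F n x - f x) \<le> G n x + g x"
        using norm_triangle_ineq4[of "F n x" "f x"] elim(1)[rule_format, of n] elim(2) by linarith
      moreover have "0 \<le> g x" by (rule order.trans[OF norm_ge_zero elim(2)])
      ultimately show ?case unfolding h_def by auto
    qed
  qed
  then have "(\<lambda>n. (\<integral>x. h n x \<partial>M) + ((\<integral>x. G n x \<partial>M) - (\<integral>x. g x \<partial>M))) \<longlonglongrightarrow> 0"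
    using tendsto_add[OF _ tendsto_diff[OF int_lim tendsto_const[of "\<integral>x. g x \<partial>M"]], of _ 0] by simp
  moreover have "norm (\<integral>x. norm (F n x - f x) \<partial>M)
      \<le> (\<integral>x. h n x \<partial>M) + ((\<integral>x. G n x \<partial>M) - (\<integral>x. g x \<partial>M))" for n
  proof -
    have int_h: "integrable M (h n)"
      unfolding h_def using G g int_f int_F[of n] by auto
    have "(\<integral>x. norm (F n x - f x) \<partial>M) \<le> (\<integral>x. h n x + (G n x - g x) \<partial>M)"
      by (rule integral_mono)
         (use G g int_f int_F[of n] int_h in \<open>auto simp: h_def\<close>)
    also have "\<dots> = (\<integral>x. h n x \<partial>M) + ((\<integral>x. G n x \<partial>M) - (\<integral>x. g x \<partial>M))"
      using G g int_h by simp
    finally show ?thesis by simp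
  qed
  ultimately have *: "(\<lambda>n. \<integral>x. norm (F n x - f x) \<partial>M) \<longlonglongrightarrow> 0"
    by (rule Lim_null_comparison[OF always_eventually[OF allI], rotated])
  have "norm ((\<integral>x. F n x \<partial>M) - (\<integral>x. f x \<partial>M)) \<le> (\<integral>x. norm (F n x - f x) \<partial>M)" for n
    using integral_norm_bound[of M "\<lambda>x. F n x - f x"] Bochner_Integration.integral_diff[OF int_F[of n] int_f]
    by simp
  with * have "(\<lambda>n. (\<integral>x. F n x \<partial>M) - (\<integral>x. f x \<partial>M)) \<longlonglongrightarrow> 0"
    by (rule Lim_null_comparison[OF always_eventually[OF allI], rotated])
  then show "(\<lambda>n. \<integral>x. F n x \<partial>M) \<longlonglongrightarrow> (\<integral>x. f x \<partial>M)"
    by (simp add: LIM_zero_iff)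
qed

section \<open>Averages over finite permutations\<close>

text \<open>
  An exchangeable law, seen as a probability measure that is preserved by an action of the finite
  permutations of \<open>nat\<close>. Since \<open>\<sigma>\<close> acts after \<open>\<tau>\<close> as \<open>\<tau> \<circ> \<sigma>\<close>, this is a right action, as is natural
  for substituting indices.
\<close>
locale symmetric_prob_space = prob_space M for M :: "'a measure" +
  fixes act :: "(nat \<Rightarrow> nat) \<Rightarrow> 'a \<Rightarrow> 'a"
  assumes act_measurable: "\<tau> permutes {..<n::nat} \<Longrightarrow> act \<tau> \<in> M \<rightarrow>\<^sub>M M"
    and distr_act: "\<tau> permutes {..<n} \<Longrightarrow> distr M M (act \<tau>) = M"
    and act_act: "act \<sigma> (act \<tau> x) = act (\<tau> \<circ> \<sigma>) x"
begin

definition avg :: "nat \<Rightarrow> ('a \<Rightarrow> 'b) \<Rightarrow> 'a \<Rightarrow> 'b::real_normed_vector" where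
  "avg n f x = (\<Sum>\<tau> | \<tau> permutes {..<n}. f (act \<tau> x)) /\<^sub>R fact n"

lemma card_perms: "card {\<tau>. \<tau> permutes {..<n::nat}} = fact n"
  by (rule card_permutations) auto

lemma finite_perms [simp]: "finite {\<tau>. \<tau> permutes {..<n::nat}}"
  by (rule finite_permutations) auto

lemma avg_const [simp]: "avg n (\<lambda>_. c) x = c"
  unfolding avg_def by (simp add: card_perms sum_constant_scaleR)

lemma avg_diff: "avg n (\<lambda>x. f x - g x) x = avg n f x - avg n g x"
  by (simp add: avg_def sum_subtractf scaleR_diff_right)

lemma avg_sum: "avg n (\<lambda>x. \<Sum>i\<in>I. f i x) x = (\<Sum>i\<in>I. avg n (f i) x)"
  unfolding avg_def by (subst sum.swap) (simp add: scaleR_sum_right)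

lemma norm_avg_le: "norm (avg n f x) \<le> avg n (\<lambda>x. norm (f x)) x"
  unfolding avg_def by (simp add: sum_norm_le mult_left_mono)

lemma avg_mono: "(\<And>x. f x \<le> g x) \<Longrightarrow> avg n f x \<le> (avg n g x :: real)"
  unfolding avg_def by (simp add: sum_mono mult_left_mono)

text \<open>Left translation by \<open>\<tau>\<close> permutes the summands of the average.\<close>
lemma avg_act:
  assumes "\<tau> permutes {..<m}" "m \<le> n"
  shows "avg n f (act \<tau> x) = avg n f x"
proof -
  have "\<tau> permutes {..<n}" using assms by (meson lessThan_subset_iff permutes_subset)
  from setum_permutations_compose_left[OF this, of "\<lambda>\<sigma>. f (act \<sigma> x)"]
  show ?thesis by (simp add: avg_def act_act)
qed

lemma avg_mult_invariant:
  fixes f h :: "'a \<Rightarrow> real"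
  assumes "\<And>\<tau>. \<tau> permutes {..<n} \<Longrightarrow> h (act \<tau> x) = h x"
  shows "avg n (\<lambda>x. h x * f x) x = h x * avg n f x"
  unfolding avg_def using assms by (simp add: sum_distrib_left mult.left_commute)

lemma avg_of_invariant:
  assumes "\<And>\<tau>. \<tau> permutes {..<n} \<Longrightarrow> f (act \<tau> x) = f x"
  shows "avg n f x = f x"
proof -
  have "avg n f x = avg n (\<lambda>_. f x) x" unfolding avg_def using assms by simp
  then show ?thesis by simp
qed

text \<open>
  The next two lemmas are the tower property: averaging over \<open>m\<close> and over \<open>n \<ge> m\<close> indices, in either
  order, amounts to averaging over \<open>n\<close> indices.
\<close>
lemma avg_avg_coarse: "m \<le> n \<Longrightarrow> avg m (avg n f) x = avg n f x"
  by (rule avg_of_invariant) (rule avg_act)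

lemma avg_avg_fine:
  assumes "m \<le> n"
  shows "avg n (avg m f) x = avg n f x"
proof -
  let ?P = "\<lambda>n. {\<tau>. \<tau> permutes {..<n::nat}}"
  have "avg n (avg m f) x = (\<Sum>\<sigma>\<in>?P n. \<Sum>\<tau>\<in>?P m. f (act (\<sigma> \<circ> \<tau>) x)) /\<^sub>R fact m /\<^sub>R fact n"
    by (simp add: avg_def act_act scaleR_sum_right mult.commute)
  also have "(\<Sum>\<sigma>\<in>?P n. \<Sum>\<tau>\<in>?P m. f (act (\<sigma> \<circ> \<tau>) x)) = (\<Sum>\<tau>\<in>?P m. \<Sum>\<sigma>\<in>?P n. f (act (\<sigma> \<circ> \<tau>) x))"
    by (rule sum.swap)
  also have "\<dots> = (\<Sum>\<tau>\<in>?P m. \<Sum>\<sigma>\<in>?P n. f (act \<sigma> x))"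
  proof (rule sum.cong[OF refl])
    fix \<tau> assume "\<tau> \<in> ?P m"
    then have "\<tau> permutes {..<n}" using assms by (auto intro: permutes_subset)
    from sum_permutations_compose_right[OF this, of "\<lambda>\<sigma>. f (act \<sigma> x)"]
    show "(\<Sum>\<sigma>\<in>?P n. f (act (\<sigma> \<circ> \<tau>) x)) = (\<Sum>\<sigma>\<in>?P n. f (act \<sigma> x))" by simp
  qed
  also have "\<dots> = fact m *\<^sub>R (\<Sum>\<sigma>\<in>?P n. f (act \<sigma> x))"
    by (simp add: sum_constant_scaleR card_perms)
  finally show ?thesis by (simp add: avg_def)
qed

lemma measurable_avg [measurable]:
  fixes f :: "'a \<Rightarrow> 'b::{banach, second_countable_topology}"
  assumes [measurable]: "f \<in> borel_measurable M"
  shows "avg n f \<in> borel_measurable M"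
proof -
  have "(\<lambda>x. f (act \<tau> x)) \<in> borel_measurable M" if "\<tau> permutes {..<n}" for \<tau>
    using act_measurable[OF that] by measurable
  then show ?thesis unfolding avg_def by (intro borel_measurable_scaleR borel_measurable_sum) auto
qed

lemma
  fixes f :: "'a \<Rightarrow> 'b::{banach, second_countable_topology}"
  assumes f: "integrable M f"
  shows integrable_avg: "integrable M (avg n f)"
    and integral_avg: "(\<integral>x. avg n f x \<partial>M) = (\<integral>x. f x \<partial>M)"
proof -
  have *: "integrable M (\<lambda>x. f (act \<tau> x))" "(\<integral>x. f (act \<tau> x) \<partial>M) = (\<integral>x. f x \<partial>M)"
    if "\<tau> permutes {..<n}" for \<tau>
    using integrable_distr[OF act_measurable[OF that], of f]
      integral_distr[OF act_measurable[OF that], of f] distr_act[OF that] f by auto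
  show "integrable M (avg n f)"
    unfolding avg_def using * by (intro integrable_scaleR_right integrable_sum) auto
  have "(\<integral>x. avg n f x \<partial>M) = (\<Sum>\<tau> | \<tau> permutes {..<n}. \<integral>x. f x \<partial>M) /\<^sub>R fact n"
    unfolding avg_def using * by simp
  also have "\<dots> = (\<integral>x. f x \<partial>M)"
    by (simp add: sum_constant_scaleR card_perms)
  finally show "(\<integral>x. avg n f x \<partial>M) = (\<integral>x. f x \<partial>M)" .
qed

lemma integral_abs_avg_le:
  fixes f :: "'a \<Rightarrow> real"
  assumes f: "integrable M f"
  shows "(\<integral>x. \<bar>avg n f x\<bar> \<partial>M) \<le> (\<integral>x. \<bar>f x\<bar> \<partial>M)"
proof -
  have "(\<integral>x. \<bar>avg n f x\<bar> \<partial>M) \<le> (\<integral>x. avg n (\<lambda>x. \<bar>f x\<bar>) x \<partial>M)"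
    using integrable_avg[OF f] integrable_avg[OF integrable_abs[OF f]] norm_avg_le[of n f]
    by (intro integral_mono) auto
  then show ?thesis using integral_avg[OF integrable_abs[OF f]] by simp
qed

text \<open>
  This says that \<open>avg n f\<close> is the conditional expectation of \<open>f\<close> given the events that the permutations
  of the first \<open>n\<close> indices preserve: an invariant factor passes through the average, and averaging
  preserves the integral.
\<close>
lemma integral_invariant_mult_avg:
  fixes f h :: "'a \<Rightarrow> real"
  assumes f: "integrable M f" and [measurable]: "h \<in> borel_measurable M"
    and bdd: "\<And>x. \<bar>h x\<bar> \<le> C"
    and inv: "\<And>\<tau> x. \<tau> permutes {..<n} \<Longrightarrow> x \<in> space M \<Longrightarrow> h (act \<tau> x) = h x"
  shows "integrable M (\<lambda>x. h x * avg n f x)"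
    and "(\<integral>x. h x * avg n f x \<partial>M) = (\<integral>x. h x * f x \<partial>M)"
proof -
  have int: "integrable M (\<lambda>x. h x * g x)" if g: "integrable M g" for g :: "'a \<Rightarrow> real"
  proof (rule Bochner_Integration.integrable_bound[of _ "\<lambda>x. C * \<bar>g x\<bar>"])
    show "integrable M (\<lambda>x. C * \<bar>g x\<bar>)" using g by simp
    show "(\<lambda>x. h x * g x) \<in> borel_measurable M" using g by measurable
    have "norm (h x * g x) \<le> norm (C * \<bar>g x\<bar>)" for x
      using mult_right_mono[OF order.trans[OF bdd[of x] abs_ge_self[of C]] abs_ge_zero[of "g x"]] by (simp add: abs_mult)
    then show "AE x in M. norm (h x * g x) \<le> norm (C * \<bar>g x\<bar>)" by simp
  qed
  show "integrable M (\<lambda>x. h x * avg n f x)"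
    by (rule int[OF integrable_avg[OF f]])
  have "(\<integral>x. h x * avg n f x \<partial>M) = (\<integral>x. avg n (\<lambda>x. h x * f x) x \<partial>M)"
    by (rule Bochner_Integration.integral_cong) (auto simp: avg_mult_invariant inv)
  also have "\<dots> = (\<integral>x. h x * f x \<partial>M)" by (rule integral_avg[OF int[OF f]])
  finally show "(\<integral>x. h x * avg n f x \<partial>M) = (\<integral>x. h x * f x \<partial>M)" .
qed

section \<open>Almost sure convergence of the averages\<close>

text \<open>
  Doob's maximal inequality. Time runs backwards, so the event is split according to the last \<open>n\<close> at
  which the average exceeds \<open>c\<close>: whether this happens at \<open>n\<close> depends only on averages over at
  least \<open>n\<close> indices, so the event \<open>E n\<close> is preserved by the permutations of the first \<open>n\<close> indices.
\<close>
lemma maximal_inequality: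
  fixes f :: "'a \<Rightarrow> real"
  assumes f: "integrable M f"
  shows "c * prob {x \<in> space M. \<exists>n\<le>N. c < \<bar>avg n f x\<bar>} \<le> (\<integral>x. \<bar>f x\<bar> \<partial>M)"
proof -
  have [measurable]: "f \<in> borel_measurable M" using f by simp
  define E where "E n = {x \<in> space M. c < \<bar>avg n f x\<bar> \<and> (\<forall>j\<in>{n<..N}. \<bar>avg j f x\<bar> \<le> c)}" for n
  have E [measurable]: "E n \<in> sets M" for n unfolding E_def by measurable
  have E_bound: "c * prob (E n) \<le> (\<integral>x. indicator (E n) x * \<bar>f x\<bar> \<partial>M)" if "n \<le> N" for n
  proof -
    have int: "integrable M (\<lambda>x. indicator (E n) x * avg n (\<lambda>x. \<bar>f x\<bar>) x)"
      and eq: "(\<integral>x. indicator (E n) x * avg n (\<lambda>x. \<bar>f x\<bar>) x \<partial>M) = (\<integral>x. indicator (E n) x * \<bar>f x\<bar> \<partial>M)"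
    proof -
      have inv: "indicator (E n) (act \<tau> x) = (indicator (E n) x :: real)"
        if "\<tau> permutes {..<n}" "x \<in> space M" for \<tau> x
        using that measurable_space[OF act_measurable, of \<tau> n x]
        by (auto simp: E_def indicator_def avg_act)
      show "integrable M (\<lambda>x. indicator (E n) x * avg n (\<lambda>x. \<bar>f x\<bar>) x)"
        "(\<integral>x. indicator (E n) x * avg n (\<lambda>x. \<bar>f x\<bar>) x \<partial>M) = (\<integral>x. indicator (E n) x * \<bar>f x\<bar> \<partial>M)"
        by (rule integral_invariant_mult_avg[where C = 1];
            use f inv in \<open>auto simp: indicator_def\<close>)+
    qed
    have "c * prob (E n) = (\<integral>x. c * indicator (E n) x \<partial>M)" by simp
    also have "\<dots> \<le> (\<integral>x. indicator (E n) x * avg n (\<lambda>x. \<bar>f x\<bar>) x \<partial>M)"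
    proof (rule integral_mono)
      fix x
      show "c * indicator (E n) x \<le> indicator (E n) x * avg n (\<lambda>x. \<bar>f x\<bar>) x"
        using norm_avg_le[of n f x] by (auto simp: E_def indicator_def)
    qed (use int in \<open>auto simp: less_top[symmetric]\<close>)
    finally show ?thesis using eq by simp
  qed
  have Un: "{x \<in> space M. \<exists>n\<le>N. c < \<bar>avg n f x\<bar>} = (\<Union>n\<le>N. E n)"
  proof safe
    fix x n assume x: "x \<in> space M" "n \<le> N" "c < \<bar>avg n f x\<bar>"
    let ?A = "{n. n \<le> N \<and> c < \<bar>avg n f x\<bar>}"
    define k where "k = Max ?A"
    have "k \<in> ?A" unfolding k_def using x by (intro Max_in) auto
    moreover have "\<bar>avg j f x\<bar> \<le> c" if "j \<in> {k<..N}" for j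
    proof (rule ccontr)
      assume "\<not> \<bar>avg j f x\<bar> \<le> c"
      then have "j \<le> k" unfolding k_def using that by (intro Max_ge) auto
      with that show False by simp
    qed
    ultimately have "x \<in> E k" "k \<le> N" using x(1) by (auto simp: E_def)
    then show "x \<in> (\<Union>n\<le>N. E n)" by blast
  qed (auto simp: E_def)
  have disj: "disjoint_family_on E {..N}"
    unfolding disjoint_family_on_def
  proof (intro ballI impI)
    fix m n assume "m \<in> {..N}" "n \<in> {..N}" "m \<noteq> n"
    then show "E m \<inter> E n = {}" by (cases m n rule: linorder_cases) (force simp: E_def)+
  qed
  have int_ind: "integrable M (\<lambda>x. indicator (E n) x * \<bar>f x\<bar>)" for n
    using integrable_mult_indicator[OF E integrable_abs[OF f]] by simp
  have "c * prob (\<Union>n\<le>N. E n) = (\<Sum>n\<le>N. c * prob (E n))"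
    using disj by (subst finite_measure_finite_Union) (auto simp: sum_distrib_left)
  also have "\<dots> \<le> (\<Sum>n\<le>N. \<integral>x. indicator (E n) x * \<bar>f x\<bar> \<partial>M)"
    using E_bound by (intro sum_mono) auto
  also have "\<dots> = (\<integral>x. (\<Sum>n\<le>N. indicator (E n) x * \<bar>f x\<bar>) \<partial>M)"
    using int_ind by (rule Bochner_Integration.integral_sum[symmetric])
  also have "\<dots> \<le> (\<integral>x. \<bar>f x\<bar> \<partial>M)"
  proof (rule integral_mono)
    fix x
    have "(\<Sum>n\<le>N. indicator (E n) x :: real) = indicator (\<Union>n\<le>N. E n) x"
      by (rule indicator_UN_disjoint[OF _ disj, symmetric]) simp
    then show "(\<Sum>n\<le>N. indicator (E n) x * \<bar>f x\<bar>) \<le> \<bar>f x\<bar>"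
      by (simp add: sum_distrib_right[symmetric] indicator_def)
  qed (rule Bochner_Integration.integrable_sum, rule int_ind, use f in simp)
  finally show ?thesis using Un by simp
qed

text \<open>
  The finer average \<open>avg m f\<close> differs from its conditional expectation \<open>avg n f\<close> by something
  orthogonal to \<open>avg n f\<close>.
\<close>
lemma integral_square_avg_diff:
  fixes f :: "'a \<Rightarrow> real"
  assumes [measurable]: "f \<in> borel_measurable M" and bdd: "\<And>x. \<bar>f x\<bar> \<le> C" and "m \<le> n"
  shows "(\<integral>x. (avg m f x - avg n f x)\<^sup>2 \<partial>M) = (\<integral>x. (avg m f x)\<^sup>2 \<partial>M) - (\<integral>x. (avg n f x)\<^sup>2 \<partial>M)"
proof -
  have bdd': "\<bar>avg k f x\<bar> \<le> C" for k x
    using norm_avg_le[of k f x] avg_mono[of "\<lambda>x. \<bar>f x\<bar>" "\<lambda>_. C" k x] bdd by simp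
  have int: "integrable M (avg k f)" for k
    by (rule integrable_const_bound[of _ C]) (use bdd' in auto)
  have int2: "integrable M (\<lambda>x. avg k f x * avg l f x)" for k l
    by (rule integrable_const_bound[of _ "C * C"])
       (use bdd' in \<open>auto simp: abs_mult intro!: mult_mono order.trans[OF abs_ge_zero bdd']\<close>)
  have inv: "avg n f (act \<tau> x) = avg n f x" if "\<tau> permutes {..<n}" for \<tau> x
    using that by (rule avg_act) simp
  have "(\<integral>x. avg n f x * avg n (avg m f) x \<partial>M) = (\<integral>x. avg n f x * avg m f x \<partial>M)"
    by (rule integral_invariant_mult_avg(2)[OF int]) (use inv bdd' in auto)
  then have cross: "(\<integral>x. avg m f x * avg n f x \<partial>M) = (\<integral>x. (avg n f x)\<^sup>2 \<partial>M)"
    using \<open>m \<le> n\<close> by (simp add: avg_avg_fine power2_eq_square mult.commute)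
  have "(\<integral>x. (avg m f x - avg n f x)\<^sup>2 \<partial>M) =
      (\<integral>x. (avg m f x * avg m f x + avg n f x * avg n f x) - 2 * (avg m f x * avg n f x) \<partial>M)"
    by (simp add: power2_eq_square algebra_simps)
  also have "\<dots> = (\<integral>x. avg m f x * avg m f x \<partial>M) + (\<integral>x. avg n f x * avg n f x \<partial>M)
      - 2 * (\<integral>x. avg m f x * avg n f x \<partial>M)"
    using int2 by simp
  finally show ?thesis using cross by (simp add: power2_eq_square)
qed

text \<open>
  The second moments of the averages decrease, hence converge, so the averages are Cauchy in mean
  square. The passage to the mean uses \<open>d \<le> e/2 + d\<^sup>2 / (e/2)\<close> for \<open>d \<ge> 0\<close>.
\<close>
lemma avg_bounded_L1_Cauchy:
  fixes f :: "'a \<Rightarrow> real"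
  assumes [measurable]: "f \<in> borel_measurable M" and bdd: "\<And>x. \<bar>f x\<bar> \<le> C" and "e > 0"
  shows "\<exists>K. \<forall>m\<ge>K. \<forall>n\<ge>m. (\<integral>x. \<bar>avg m f x - avg n f x\<bar> \<partial>M) \<le> e"
proof -
  define b where "b n = (\<integral>x. (avg n f x)\<^sup>2 \<partial>M)" for n
  have dec: "decseq b"
    unfolding decseq_def b_def
  proof safe
    fix m n :: nat assume "m \<le> n"
    then show "(\<integral>x. (avg n f x)\<^sup>2 \<partial>M) \<le> (\<integral>x. (avg m f x)\<^sup>2 \<partial>M)"
      using integral_square_avg_diff[OF assms(1,2), of m n]
        Bochner_Integration.integral_nonneg[of M "\<lambda>x. (avg m f x - avg n f x)\<^sup>2"] by simp
  qed
  then have "convergent b"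
    by (rule decseq_convergent[of b 0]) (auto simp: b_def convergentI)
  then have "Cauchy b" by (rule convergent_Cauchy)
  then obtain K where K: "\<And>m n. m \<ge> K \<Longrightarrow> n \<ge> K \<Longrightarrow> \<bar>b m - b n\<bar> < (e/2)\<^sup>2"
    using \<open>e > 0\<close> by (auto simp: Cauchy_def dist_real_def dest!: spec[of _ "(e/2)\<^sup>2"])
  have bdd': "\<bar>avg k f x\<bar> \<le> C" for k x
    using norm_avg_le[of k f x] avg_mono[of "\<lambda>x. \<bar>f x\<bar>" "\<lambda>_. C" k x] bdd by simp
  show ?thesis
  proof (intro exI allI impI)
    fix m n assume mn: "K \<le> m" "m \<le> n"
    let ?d = "\<lambda>x. avg m f x - avg n f x"
    have d_bdd: "\<bar>?d x\<bar> \<le> 2 * C" for x using bdd'[of m x] bdd'[of n x] by simp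
    have int: "integrable M ?d" by (rule integrable_const_bound[of _ "2 * C"]) (use d_bdd in auto)
    have int2: "integrable M (\<lambda>x. (?d x)\<^sup>2)"
      by (rule integrable_const_bound[of _ "(2 * C)\<^sup>2"])
         (use power_mono[OF d_bdd abs_ge_zero, where n = 2] in auto)
    have "\<bar>?d x\<bar> \<le> e/2 + (?d x)\<^sup>2 / (e/2)" for x
    proof (cases "\<bar>?d x\<bar> \<le> e/2")
      case False
      then have "(e/2) * \<bar>?d x\<bar> \<le> \<bar>?d x\<bar> * \<bar>?d x\<bar>" by (intro mult_right_mono) auto
      then have "\<bar>?d x\<bar> \<le> (?d x)\<^sup>2 / (e/2)" using \<open>e > 0\<close> by (simp add: field_simps power2_eq_square)
      then show ?thesis using \<open>e > 0\<close> by linarith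
    qed (use \<open>e > 0\<close> in \<open>auto intro: add_increasing2\<close>)
    then have "(\<integral>x. \<bar>?d x\<bar> \<partial>M) \<le> (\<integral>x. e/2 + (?d x)\<^sup>2 / (e/2) \<partial>M)"
      using int int2 by (intro integral_mono) auto
    also have "\<dots> = e/2 + (b m - b n) / (e/2)"
      using int2 integral_square_avg_diff[OF assms(1,2) \<open>m \<le> n\<close>] by (simp add: b_def prob_space)
    also have "\<dots> \<le> e/2 + (e/2)\<^sup>2 / (e/2)"
      using K[of m n] mn \<open>e > 0\<close> by (intro add_left_mono divide_right_mono) auto
    also have "\<dots> = e" using \<open>e > 0\<close> by (simp add: power2_eq_square)
    finally show "(\<integral>x. \<bar>?d x\<bar> \<partial>M) \<le> e" .
  qed
qed

text \<open>Truncation reduces this to the bounded case, because averaging is a contraction in mean.\<close>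
lemma avg_L1_Cauchy:
  fixes f :: "'a \<Rightarrow> real"
  assumes f: "integrable M f" and "e > 0"
  shows "\<exists>K. \<forall>m\<ge>K. \<forall>n\<ge>m. (\<integral>x. \<bar>avg m f x - avg n f x\<bar> \<partial>M) \<le> e"
proof -
  have [measurable]: "f \<in> borel_measurable M" using f by simp
  define t where "t C x = max (- real C) (min (real C) (f x))" for C :: nat and x
  have [measurable]: "t C \<in> borel_measurable M" for C unfolding t_def by measurable
  have "(\<lambda>C. \<integral>x. \<bar>f x - t C x\<bar> \<partial>M) \<longlonglongrightarrow> (\<integral>x. 0 \<partial>M)"
  proof (rule integral_dominated_convergence[where w = "\<lambda>x. \<bar>f x\<bar>"])
    have "(\<lambda>C. \<bar>f x - t C x\<bar>) \<longlonglongrightarrow> 0" for x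
    proof (rule tendsto_eventually)
      obtain K :: nat where "\<bar>f x\<bar> \<le> real K" using real_arch_simple by blast
      then show "\<forall>\<^sub>F C in sequentially. \<bar>f x - t C x\<bar> = 0"
        by (intro eventually_sequentiallyI[of K]) (auto simp: t_def max_def min_def)
    qed
    then show "AE x in M. (\<lambda>C. \<bar>f x - t C x\<bar>) \<longlonglongrightarrow> 0" by simp
  qed (use f in \<open>auto simp: t_def\<close>)
  then have "\<forall>\<^sub>F C in sequentially. (\<integral>x. \<bar>f x - t C x\<bar> \<partial>M) < e/3"
    using \<open>e > 0\<close> by (intro order_tendstoD) auto
  then obtain C where C: "(\<integral>x. \<bar>f x - t C x\<bar> \<partial>M) < e/3"
    using eventually_happens' sequentially_bot by blast
  have t_bdd: "\<bar>t C x\<bar> \<le> real C" for x by (auto simp: t_def)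
  have int_t: "integrable M (t C)"
    by (rule integrable_const_bound[of _ "real C"]) (use t_bdd in auto)
  let ?r = "\<lambda>x. f x - t C x"
  have int_r: "integrable M ?r" using f int_t by simp
  obtain K where K: "\<forall>m\<ge>K. \<forall>n\<ge>m. (\<integral>x. \<bar>avg m (t C) x - avg n (t C) x\<bar> \<partial>M) \<le> e/3"
    using avg_bounded_L1_Cauchy[of "t C" "real C" "e/3"] t_bdd \<open>e > 0\<close> by auto
  show ?thesis
  proof (intro exI allI impI)
    fix m n assume mn: "K \<le> m" "m \<le> n"
    have int: "integrable M (avg k (t C))" "integrable M (avg k ?r)" "integrable M (avg k f)" for k
      using integrable_avg[OF int_t] integrable_avg[OF int_r] integrable_avg[OF f] by auto
    have "(\<integral>x. \<bar>avg m f x - avg n f x\<bar> \<partial>M)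
        \<le> (\<integral>x. \<bar>avg m (t C) x - avg n (t C) x\<bar> + (\<bar>avg m ?r x\<bar> + \<bar>avg n ?r x\<bar>) \<partial>M)"
      using int by (intro integral_mono Bochner_Integration.integrable_add integrable_abs
          Bochner_Integration.integrable_diff) (auto simp: avg_diff)
    also have "\<dots> = (\<integral>x. \<bar>avg m (t C) x - avg n (t C) x\<bar> \<partial>M) + ((\<integral>x. \<bar>avg m ?r x\<bar> \<partial>M) + (\<integral>x. \<bar>avg n ?r x\<bar> \<partial>M))"
      using int by simp
    also have "\<dots> \<le> e/3 + (e/3 + e/3)"
      using K mn integral_abs_avg_le[OF int_r, of m] integral_abs_avg_le[OF int_r, of n] C
      by (intro add_mono) auto
    finally show "(\<integral>x. \<bar>avg m f x - avg n f x\<bar> \<partial>M) \<le> e" by simp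
  qed
qed

text \<open>
  For \<open>m \<le> n \<le> N\<close> the average over \<open>n\<close> of \<open>avg m f - avg N f\<close> is \<open>avg n f - avg N f\<close>. So the
  maximal inequality bounds all oscillations between \<open>m\<close> and \<open>N\<close> by the distance in mean of \<open>avg m f\<close>
  and \<open>avg N f\<close>, which is small for large \<open>m\<close>, uniformly in \<open>N\<close>.
\<close>
lemma AE_eventually_close:
  fixes f :: "'a \<Rightarrow> real"
  assumes f: "integrable M f" and "c > 0"
  shows "AE x in M. \<exists>m. \<forall>n\<ge>m. \<bar>avg n f x - avg m f x\<bar> \<le> 2 * c"
proof -
  have [measurable]: "f \<in> borel_measurable M" using f by simp
  define B where "B m N = {x \<in> space M. \<exists>n\<in>{m..N}. 2 * c < \<bar>avg n f x - avg m f x\<bar>}" for m N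
  define Z where "Z = {x \<in> space M. \<forall>m. \<exists>n\<ge>m. 2 * c < \<bar>avg n f x - avg m f x\<bar>}"
  have [measurable]: "B m N \<in> sets M" "Z \<in> sets M" for m N unfolding B_def Z_def by measurable
  have B_bound: "c * prob (B m N) \<le> (\<integral>x. \<bar>avg m f x - avg N f x\<bar> \<partial>M)" if "m \<le> N" for m N
  proof -
        \<comment> \<open>The average over \<open>N\<close> stands in for the limit, which is not yet available.\<close>
let ?g = "\<lambda>x. avg m f x - avg N f x"
    have g: "integrable M ?g" using integrable_avg[OF f] by simp
    have avg_g: "avg n ?g x = avg n f x - avg N f x" if "n \<in> {m..N}" for n x
      using that by (simp add: avg_diff avg_avg_fine avg_avg_coarse)
    have "B m N \<subseteq> {x \<in> space M. \<exists>n\<le>N. c < \<bar>avg n ?g x\<bar>}"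
    proof
      fix x assume "x \<in> B m N"
      then obtain n where n: "x \<in> space M" "n \<in> {m..N}" "2 * c < \<bar>avg n f x - avg m f x\<bar>"
        by (auto simp: B_def)
      then have "c < \<bar>avg n f x - avg N f x\<bar> \<or> c < \<bar>avg m f x - avg N f x\<bar>" by linarith
      then have "c < \<bar>avg n ?g x\<bar> \<or> c < \<bar>avg m ?g x\<bar>" using n that avg_g by simp
      then have "\<exists>k\<le>N. c < \<bar>avg k ?g x\<bar>" using n(2) that by (auto simp only: atLeastAtMost_iff)
      then show "x \<in> {x \<in> space M. \<exists>n\<le>N. c < \<bar>avg n ?g x\<bar>}" using n(1) by blast
    qed
    moreover have "{x \<in> space M. \<exists>n\<le>N. c < \<bar>avg n ?g x\<bar>} \<in> sets M" by measurable
    ultimately have "c * prob (B m N) \<le> c * prob {x \<in> space M. \<exists>n\<le>N. c < \<bar>avg n ?g x\<bar>}"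
      using \<open>c > 0\<close> by (intro mult_left_mono finite_measure_mono) auto
    also have "\<dots> \<le> (\<integral>x. \<bar>?g x\<bar> \<partial>M)" by (rule maximal_inequality[OF g])
    finally show ?thesis .
  qed
  have "c * prob Z \<le> e" if "e > 0" for e
  proof -
    obtain K where K: "\<forall>m\<ge>K. \<forall>n\<ge>m. (\<integral>x. \<bar>avg m f x - avg n f x\<bar> \<partial>M) \<le> e"
      using avg_L1_Cauchy[OF f \<open>e > 0\<close>] by blast
    have Z: "Z \<subseteq> (\<Union>N. B K (K + N))"
    proof
      fix x assume "x \<in> Z"
      then obtain n where "x \<in> space M" "n \<ge> K" "2 * c < \<bar>avg n f x - avg K f x\<bar>"
        by (auto simp: Z_def)
      then have "x \<in> B K (K + (n - K))" by (auto simp: B_def)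
      then show "x \<in> (\<Union>N. B K (K + N))" by blast
    qed
    have "(\<lambda>N. prob (B K (K + N))) \<longlonglongrightarrow> prob (\<Union>N. B K (K + N))"
      by (rule finite_Lim_measure_incseq) (auto simp: incseq_def B_def)
    then have "(\<lambda>N. c * prob (B K (K + N))) \<longlonglongrightarrow> c * prob (\<Union>N. B K (K + N))"
      by (rule tendsto_mult_left)
    moreover have "c * prob (B K (K + N)) \<le> e" for N
      using B_bound[of K "K + N"] K by (meson le_add1 le_refl order_trans)
    ultimately have "c * prob (\<Union>N. B K (K + N)) \<le> e"
      by (intro LIMSEQ_le_const2) auto
    moreover have "prob Z \<le> prob (\<Union>N. B K (K + N))"
      by (rule finite_measure_mono[OF Z]) auto
    ultimately show ?thesis using \<open>c > 0\<close> by (meson less_le_not_le mult_left_mono nle_le order_trans)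
  qed
  then have "c * prob Z \<le> 0" using field_le_epsilon[of "c * prob Z" 0] by simp
  then have "prob Z = 0" using \<open>c > 0\<close> by (simp add: mult_le_0_iff measure_le_0_iff)
  then have "AE x in M. x \<notin> Z" by (simp add: prob_eq_0)
  then show ?thesis
    using AE_space by eventually_elim (auto simp: Z_def not_less)
qed

text \<open>
  The convergence theorem for reverse martingales, for averages. Fatou's lemma transfers the
  Cauchy property in mean to the almost sure limit, so that the limit keeps the integral.
\<close>
theorem avg_converges_real:
  fixes f :: "'a \<Rightarrow> real"
  assumes f: "integrable M f"
  obtains V where "integrable M V" "AE x in M. (\<lambda>n. avg n f x) \<longlonglongrightarrow> V x" "(\<integral>x. V x \<partial>M) = (\<integral>x. f x \<partial>M)"
proof -
  have [measurable]: "f \<in> borel_measurable M" using f by simp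
  define V where "V x = lim (\<lambda>n. avg n f x)" for x
  have V [measurable]: "V \<in> borel_measurable M" unfolding V_def by measurable
  have "AE x in M. \<forall>j. \<exists>m. \<forall>n\<ge>m. \<bar>avg n f x - avg m f x\<bar> \<le> 2 * (1 / real (Suc j))"
    unfolding AE_all_countable by (intro allI AE_eventually_close[OF f]) simp
  then have lim: "AE x in M. (\<lambda>n. avg n f x) \<longlonglongrightarrow> V x"
  proof eventually_elim
    case (elim x)
    have "Cauchy (\<lambda>n. avg n f x)"
      unfolding Cauchy_altdef2
    proof safe
      fix e :: real assume "e > 0"
      then obtain j where "1 / real (Suc j) < e / 2" by (rule nat_approx_posE[OF half_gt_zero])
      then have "2 * (1 / real (Suc j)) < e" by linarith
      moreover obtain m where "\<forall>n\<ge>m. \<bar>avg n f x - avg m f x\<bar> \<le> 2 * (1 / real (Suc j))"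
        using elim by blast
      ultimately show "\<exists>N. \<forall>n\<ge>N. dist (avg n f x) (avg N f x) < e"
        unfolding dist_real_def by (meson le_less_trans)
    qed
    then have "convergent (\<lambda>n. avg n f x)" by (rule Cauchy_convergent)
    then show ?case by (simp add: V_def convergent_LIMSEQ_iff)
  qed
  have fatou: "integrable M (\<lambda>x. avg m f x - V x) \<and> (\<integral>x. \<bar>avg m f x - V x\<bar> \<partial>M) \<le> e"
    if K: "\<forall>n\<ge>m. (\<integral>x. \<bar>avg m f x - avg n f x\<bar> \<partial>M) \<le> e" and "e > 0" for m e
  proof -
    have int: "integrable M (\<lambda>x. avg m f x - avg n f x)" for n using integrable_avg[OF f] by simp
    have "(\<integral>\<^sup>+x. ennreal \<bar>avg m f x - V x\<bar> \<partial>M)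
        \<le> (\<integral>\<^sup>+x. liminf (\<lambda>n. ennreal \<bar>avg m f x - avg n f x\<bar>) \<partial>M)"
    proof (rule nn_integral_mono_AE)
      show "AE x in M. ennreal \<bar>avg m f x - V x\<bar> \<le> liminf (\<lambda>n. ennreal \<bar>avg m f x - avg n f x\<bar>)"
        using lim
      proof eventually_elim
        case (elim x)
        then have "(\<lambda>n. ennreal \<bar>avg m f x - avg n f x\<bar>) \<longlonglongrightarrow> ennreal \<bar>avg m f x - V x\<bar>"
          by (intro tendsto_intros)
        from lim_imp_Liminf[OF _ this] show ?case by simp
      qed
    qed
    also have "\<dots> \<le> liminf (\<lambda>n. \<integral>\<^sup>+x. ennreal \<bar>avg m f x - avg n f x\<bar> \<partial>M)"
      by (rule nn_integral_liminf) measurable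
    also have "\<dots> \<le> ennreal e"
    proof -
      have "\<forall>\<^sub>F n in sequentially. (\<integral>\<^sup>+x. ennreal \<bar>avg m f x - avg n f x\<bar> \<partial>M) \<le> ennreal e"
        using eventually_ge_at_top[of m]
      proof eventually_elim
        case (elim n)
        have "(\<integral>\<^sup>+x. ennreal \<bar>avg m f x - avg n f x\<bar> \<partial>M) = ennreal (\<integral>x. \<bar>avg m f x - avg n f x\<bar> \<partial>M)"
          using int by (intro nn_integral_eq_integral) auto
        also have "\<dots> \<le> ennreal e" using K elim by (intro ennreal_leI) auto
        finally show ?case .
      qed
      then have "limsup (\<lambda>n. \<integral>\<^sup>+x. ennreal \<bar>avg m f x - avg n f x\<bar> \<partial>M) \<le> ennreal e"
        by (rule Limsup_bounded)
      then show ?thesis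
        by (rule order.trans[OF Liminf_le_Limsup[OF sequentially_bot]])
    qed
    finally have nn: "(\<integral>\<^sup>+x. ennreal \<bar>avg m f x - V x\<bar> \<partial>M) \<le> ennreal e" .
    have "integrable M (\<lambda>x. avg m f x - V x)"
      using nn by (intro integrableI_bounded) (auto simp: le_less_trans[OF _ ennreal_less_top])
    moreover from this have "(\<integral>\<^sup>+x. ennreal \<bar>avg m f x - V x\<bar> \<partial>M) = ennreal (\<integral>x. \<bar>avg m f x - V x\<bar> \<partial>M)"
      by (intro nn_integral_eq_integral) auto
    ultimately show ?thesis using nn \<open>e > 0\<close> by (simp add: ennreal_le_iff)
  qed
  obtain K1 where "\<forall>m\<ge>K1. \<forall>n\<ge>m. (\<integral>x. \<bar>avg m f x - avg n f x\<bar> \<partial>M) \<le> 1"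
    using avg_L1_Cauchy[OF f, of 1] by auto
  then have "integrable M (\<lambda>x. avg K1 f x - V x)" using fatou[of K1 1] by simp
  from Bochner_Integration.integrable_diff[OF integrable_avg[OF f, of K1] this]
  have int_V: "integrable M V" by simp
  have "\<bar>(\<integral>x. f x \<partial>M) - (\<integral>x. V x \<partial>M)\<bar> \<le> e" if "e > 0" for e
  proof -
    obtain K where "\<forall>m\<ge>K. \<forall>n\<ge>m. (\<integral>x. \<bar>avg m f x - avg n f x\<bar> \<partial>M) \<le> e"
      using avg_L1_Cauchy[OF f \<open>e > 0\<close>] by auto
    then have K: "(\<integral>x. \<bar>avg K f x - V x\<bar> \<partial>M) \<le> e" using fatou[of K e] that by auto
    have "(\<integral>x. f x \<partial>M) - (\<integral>x. V x \<partial>M) = (\<integral>x. avg K f x - V x \<partial>M)"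
      using integrable_avg[OF f, of K] integral_avg[OF f, of K] int_V by simp
    then show ?thesis using order.trans[OF integral_abs_bound K] by simp
  qed
  then have "(\<integral>x. V x \<partial>M) = (\<integral>x. f x \<partial>M)"
    using field_le_epsilon[of "\<bar>(\<integral>x. f x \<partial>M) - (\<integral>x. V x \<partial>M)\<bar>" 0] by simp
  with int_V lim that show ?thesis by blast
qed

theorem avg_converges:
  fixes f :: "'a \<Rightarrow> complex"
  assumes f: "integrable M f"
  obtains V where "integrable M V" "AE x in M. (\<lambda>n. avg n f x) \<longlonglongrightarrow> V x" "(\<integral>x. V x \<partial>M) = (\<integral>x. f x \<partial>M)"
proof -
  obtain R where R: "integrable M R" "AE x in M. (\<lambda>n. avg n (\<lambda>x. Re (f x)) x) \<longlonglongrightarrow> R x"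
    "(\<integral>x. R x \<partial>M) = (\<integral>x. Re (f x) \<partial>M)"
    using avg_converges_real[OF integrable_Re[OF f]] by blast
  obtain I where I: "integrable M I" "AE x in M. (\<lambda>n. avg n (\<lambda>x. Im (f x)) x) \<longlonglongrightarrow> I x"
    "(\<integral>x. I x \<partial>M) = (\<integral>x. Im (f x) \<partial>M)"
    using avg_converges_real[OF integrable_Im[OF f]] by blast
  have ReIm: "avg n f x = Complex (avg n (\<lambda>x. Re (f x)) x) (avg n (\<lambda>x. Im (f x)) x)" for n x
    by (simp add: avg_def complex_eq_iff)
  show ?thesis
  proof (rule that[of "\<lambda>x. Complex (R x) (I x)"])
    have "Complex (R x) (I x) = complex_of_real (R x) + \<i> * complex_of_real (I x)" for x
      by (simp add: complex_eq_iff)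
    then show int: "integrable M (\<lambda>x. Complex (R x) (I x))" using R(1) I(1) by simp
    show "AE x in M. (\<lambda>n. avg n f x) \<longlonglongrightarrow> Complex (R x) (I x)"
      using R(2) I(2) by eventually_elim (auto simp: ReIm tendsto_Complex)
    show "(\<integral>x. Complex (R x) (I x) \<partial>M) = (\<integral>x. f x \<partial>M)"
      using R(3) I(3) integral_Re[OF int] integral_Im[OF int] integral_Re[OF f] integral_Im[OF f]
      by (simp add: complex_eq_iff)
  qed
qed

end

section \<open>Principal minors and characteristic coefficients\<close>

text \<open>
  The principal minor with rows and columns in \<open>S\<close>. The Leibniz formula is used with permutations of
  \<open>S\<close> itself, which avoids renumbering the indices.
\<close>
definition minor :: "nat set \<Rightarrow> (nat \<Rightarrow> nat \<Rightarrow> complex) \<Rightarrow> complex" where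
  "minor S H = (\<Sum>p | p permutes S. of_int (sign p) * (\<Prod>i\<in>S. H i (p i)))"

definition relabel :: "(nat \<Rightarrow> nat) \<Rightarrow> (nat \<Rightarrow> nat \<Rightarrow> complex) \<Rightarrow> nat \<Rightarrow> nat \<Rightarrow> complex" where
  "relabel \<tau> H = (\<lambda>i j. H (\<tau> i) (\<tau> j))"

definition minor_sum :: "nat set \<Rightarrow> nat \<Rightarrow> (nat \<Rightarrow> nat \<Rightarrow> complex) \<Rightarrow> complex" where
  "minor_sum S k H = (\<Sum>T | T \<subseteq> S \<and> card T = k. minor T H)"

lemma minor_lessThan: "minor {..<k} H = det (corner k H)"
proof -
  have "det (corner k H) = (\<Sum>p | p permutes {0..<k}. of_int (sign p) * (\<Prod>i = 0..<k. corner k H $$ (i, p i)))"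
    by (rule det_def') (auto simp: corner_def)
  also have "\<dots> = minor {..<k} H"
    unfolding minor_def
  proof (rule sum.cong)
    show "{p. p permutes {0..<k}} = {p. p permutes {..<k}}" by (simp add: atLeast0LessThan)
    fix p assume "p \<in> {p. p permutes {..<k}}"
    then have "p i < k" if "i < k" for i using that permutes_in_image[of p "{..<k}" i] by simp
    then show "of_int (sign p) * (\<Prod>i = 0..<k. corner k H $$ (i, p i)) = of_int (sign p) * (\<Prod>i<k. H i (p i))"
      by (simp add: corner_def atLeast0LessThan)
  qed
  finally show ?thesis by simp
qed

text \<open>Conjugation with \<open>\<tau>\<close> carries the permutations of \<open>S\<close> to those of \<open>\<tau> ` S\<close> and preserves signs.\<close>
lemma minor_image:
  assumes "finite S" and inj: "inj_on \<tau> S"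
  shows "minor (\<tau> ` S) H = minor S (relabel \<tau> H)"
proof -
  let ?m = "map_permutation S \<tau>"
  have bij: "bij_betw \<tau> S (\<tau> ` S)" using inj by (rule inj_on_imp_bij_betw)
  have "bij_betw ?m {p. p permutes S} {p. p permutes \<tau> ` S}"
  proof (rule bij_betw_byWitness[where f' = "map_permutation (\<tau> ` S) (inv_into S \<tau>)"])
    show "\<forall>p\<in>{p. p permutes S}. map_permutation (\<tau> ` S) (inv_into S \<tau>) (?m p) = p"
      using map_permutation_compose_inv[OF bij] inj by auto
    show "\<forall>p\<in>{p. p permutes \<tau> ` S}. ?m (map_permutation (\<tau> ` S) (inv_into S \<tau>) p) = p"
      using map_permutation_compose_inv[OF bij_betw_inv_into[OF bij]] inj by (auto simp: f_inv_into_f)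
    show "?m ` {p. p permutes S} \<subseteq> {p. p permutes \<tau> ` S}"
      using map_permutation_permutes[OF bij] by auto
    show "map_permutation (\<tau> ` S) (inv_into S \<tau>) ` {p. p permutes \<tau> ` S} \<subseteq> {p. p permutes S}"
      using map_permutation_permutes[OF bij_betw_inv_into[OF bij]] by auto
  qed
  from sum.reindex_bij_betw[OF this, of "\<lambda>p. of_int (sign p) * (\<Prod>i\<in>\<tau> ` S. H i (p i))"]
  have "minor (\<tau> ` S) H = (\<Sum>p | p permutes S. of_int (sign (?m p)) * (\<Prod>i\<in>\<tau> ` S. H i (?m p i)))"
    by (simp add: minor_def)
  also have "\<dots> = minor S (relabel \<tau> H)"
    unfolding minor_def relabel_def
  proof (rule sum.cong[OF refl])
    fix p assume "p \<in> {p. p permutes S}"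
    then have p: "p permutes S" by simp
    have "sign (?m p) = sign p" using p inj \<open>finite S\<close> by (simp add: sign_map_permutation)
    moreover have "(\<Prod>i\<in>\<tau> ` S. H i (?m p i)) = (\<Prod>i\<in>S. H (\<tau> i) (?m p (\<tau> i)))"
      by (rule prod.reindex_cong[OF inj refl]) simp
    moreover have "\<dots> = (\<Prod>i\<in>S. H (\<tau> i) (\<tau> (p i)))"
      using inj by (intro prod.cong refl) (simp add: map_permutation_apply)
    ultimately show "of_int (sign (?m p)) * (\<Prod>i\<in>\<tau> ` S. H i (?m p i))
        = of_int (sign p) * (\<Prod>i\<in>S. H (\<tau> i) (\<tau> (p i)))" by simp
  qed
  finally show ?thesis .
qed

lemma permutes_subset_iff:
  assumes "p permutes A" "S \<subseteq> A"
  shows "p permutes S \<longleftrightarrow> (\<forall>i\<in>A - S. p i = i)"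
  using assms permutes_superset[of p A S] by (auto simp: permutes_not_in)

text \<open>
  Each entry of the polynomial matrix is a linear monomial plus an entry of the identity matrix.
  Expanding a product of entries in the Leibniz formula selects the set \<open>S\<close> of rows from which the
  monomial is taken; the identity matrix then forces the permutation to fix everything outside \<open>S\<close>.
\<close>
lemma rcoeff_eq_minor_sum:
  "rcoeff N k H = (- 1 / of_nat N) ^ k * minor_sum {..<N} k H"
proof -
  define c where "c = (- 1 / of_nat N :: complex)"
  let ?A = "1\<^sub>m N - monom (1 / of_nat N) 1 \<cdot>\<^sub>m map_mat (\<lambda>c. [:c:]) (corner N H)"
  let ?w = "\<lambda>p S. \<Prod>i\<in>S. H i (p i)"
  have entry: "?A $$ (i, j) = monom (c * H i j) 1 + of_bool (j = i)" if "i < N" "j < N" for i j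
    using that by (auto simp: corner_def c_def one_mat_def monom_altdef)
  have prod_eq: "(\<Prod>i<N. ?A $$ (i, p i)) =
      (\<Sum>S\<in>Pow {..<N}. if p permutes S then monom (c ^ card S * ?w p S) (card S) else 0)"
    if p: "p permutes {..<N}" for p
  proof -
    have "p i < N" if "i < N" for i using that permutes_in_image[OF p, of i] by simp
    then have "(\<Prod>i<N. ?A $$ (i, p i)) = (\<Prod>i<N. monom (c * H i (p i)) 1 + of_bool (p i = i))"
      by (intro prod.cong refl) (use entry in auto)
    also have "\<dots> = (\<Sum>S\<in>Pow {..<N}. (\<Prod>i\<in>S. monom (c * H i (p i)) 1) * (\<Prod>i\<in>{..<N} - S. of_bool (p i = i)))"
      by (rule prod_add) simp
    also have "\<dots> = (\<Sum>S\<in>Pow {..<N}. if p permutes S then monom (c ^ card S * ?w p S) (card S) else 0)"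
    proof (rule sum.cong[OF refl])
      fix S assume "S \<in> Pow {..<N}"
      then have S: "S \<subseteq> {..<N}" "finite S" by (auto intro: finite_subset)
      have "(\<Prod>i\<in>S. monom (c * H i (p i)) 1) = monom (c ^ card S * ?w p S) (card S)"
        using S(2) by (induction S) (auto simp: mult_monom algebra_simps)
      moreover have "(\<Prod>i\<in>{..<N} - S. of_bool (p i = i) :: complex poly) = of_bool (p permutes S)"
        unfolding permutes_subset_iff[OF p S(1)] by (auto intro: prod.neutral)
      ultimately show "(\<Prod>i\<in>S. monom (c * H i (p i)) 1) * (\<Prod>i\<in>{..<N} - S. of_bool (p i = i)) =
          (if p permutes S then monom (c ^ card S * ?w p S) (card S) else 0)" by simp
    qed
    finally show ?thesis .
  qed
  have fin: "finite {p. p permutes {..<N}}" by (simp add: finite_permutations)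
  have coeff_eq: "coeff (of_int (sign p) * (\<Prod>i<N. ?A $$ (i, p i))) k =
      (\<Sum>S | S \<subseteq> {..<N} \<and> card S = k. if p permutes S then of_int (sign p) * (c ^ k * ?w p S) else 0)"
    if p: "p permutes {..<N}" for p
  proof -
    have "coeff (of_int (sign p) * (\<Prod>i<N. ?A $$ (i, p i))) k = of_int (sign p) * coeff (\<Prod>i<N. ?A $$ (i, p i)) k"
      by (auto simp: sign_def)
    also have "coeff (\<Prod>i<N. ?A $$ (i, p i)) k =
        (\<Sum>S\<in>Pow {..<N}. if card S = k then (if p permutes S then c ^ k * ?w p S else 0) else 0)"
      unfolding prod_eq[OF p] coeff_sum by (intro sum.cong refl) auto
    also have "\<dots> = (\<Sum>S | S \<subseteq> {..<N} \<and> card S = k. if p permutes S then c ^ k * ?w p S else 0)"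
      by (subst sum.inter_filter[symmetric]) (auto intro: sum.cong)
    finally show ?thesis by (simp add: sum_distrib_left if_distrib cong: if_cong)
  qed
  have "rcoeff N k H = coeff (det ?A) k" by (simp add: rcoeff_def rev_char_poly_def)
  also have "det ?A = (\<Sum>p | p permutes {0..<N}. signof p * (\<Prod>i = 0..<N. ?A $$ (i, p i)))"
    by (rule det_def') (auto simp: corner_def)
  also have "coeff \<dots> k = (\<Sum>p | p permutes {..<N}. \<Sum>S | S \<subseteq> {..<N} \<and> card S = k.
      if p permutes S then of_int (sign p) * (c ^ k * ?w p S) else 0)"
    unfolding coeff_sum atLeast0LessThan by (intro sum.cong refl) (use coeff_eq in auto)
  also have "\<dots> = (\<Sum>S | S \<subseteq> {..<N} \<and> card S = k. \<Sum>p | p permutes {..<N}.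
      if p permutes S then of_int (sign p) * (c ^ k * ?w p S) else 0)"
    by (rule sum.swap)
  also have "\<dots> = (\<Sum>S | S \<subseteq> {..<N} \<and> card S = k. c ^ k * minor S H)"
  proof (rule sum.cong[OF refl])
    fix S assume S: "S \<in> {S. S \<subseteq> {..<N} \<and> card S = k}"
    have "{p \<in> {p. p permutes {..<N}}. p permutes S} = {p. p permutes S}"
      using S by (auto intro: permutes_subset)
    then show "(\<Sum>p | p permutes {..<N}. if p permutes S then of_int (sign p) * (c ^ k * ?w p S) else 0)
        = c ^ k * minor S H"
      using sum.inter_filter[OF fin, of "\<lambda>p. of_int (sign p) * (c ^ k * ?w p S)" "\<lambda>p. p permutes S"]
      by (simp add: minor_def sum_distrib_left mult_ac)
  qed
  finally show ?thesis by (simp add: minor_sum_def c_def sum_distrib_left)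
qed

section \<open>Set functions of bounded degree\<close>

text \<open>
  A set function is a polynomial of degree at most \<open>d\<close> if it is a sum over subsets with at most \<open>d\<close>
  elements.
\<close>
definition subset_degree_le :: "nat \<Rightarrow> ('a set \<Rightarrow> 'b::comm_ring_1) \<Rightarrow> bool" where
  "subset_degree_le d F \<longleftrightarrow> (\<exists>f. (\<forall>S. finite S \<longrightarrow> F S = sum f (Pow S)) \<and>
     (\<forall>S. finite S \<and> d < card S \<longrightarrow> f S = 0))"

lemma subset_degree_le_one: "subset_degree_le 0 (\<lambda>_. 1)"
  unfolding subset_degree_le_def
proof (intro exI[of _ "\<lambda>S. if S = {} then 1 else 0"] conjI allI impI)
  fix S :: "'a set" assume "finite S"
  then show "1 = (\<Sum>T\<in>Pow S. if T = {} then 1 else 0 :: 'b)" by (simp add: sum.delta)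
qed auto

lemma subset_degree_le_layer:
  "subset_degree_le k (\<lambda>S. \<Sum>T | T \<subseteq> S \<and> card T = k. f T)"
  unfolding subset_degree_le_def
proof (intro exI[of _ "\<lambda>T. if card T = k then f T else 0"] conjI allI impI)
  fix S :: "'a set" assume "finite S"
  then have "(\<Sum>T\<in>Pow S. if card T = k then f T else 0) = sum f {T \<in> Pow S. card T = k}"
    using sum.inter_filter[of "Pow S" f "\<lambda>T. card T = k"] by simp
  then show "(\<Sum>T | T \<subseteq> S \<and> card T = k. f T) = (\<Sum>T\<in>Pow S. if card T = k then f T else 0)"
    by (simp add: Pow_def)
qed auto

text \<open>
  A pair of subsets \<open>A\<close>, \<open>B\<close> of \<open>S\<close> contributes to the subset \<open>A \<union> B\<close>, whose size is at most
  \<open>card A + card B\<close>.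
\<close>
lemma subset_degree_le_mult:
  assumes "subset_degree_le d F" "subset_degree_le e G"
  shows "subset_degree_le (d + e) (\<lambda>S. F S * G S)"
proof -
  obtain f where f: "\<And>S. finite S \<Longrightarrow> F S = sum f (Pow S)" "\<And>S. finite S \<Longrightarrow> d < card S \<Longrightarrow> f S = 0"
    using assms(1) by (auto simp: subset_degree_le_def)
  obtain g where g: "\<And>S. finite S \<Longrightarrow> G S = sum g (Pow S)" "\<And>S. finite S \<Longrightarrow> e < card S \<Longrightarrow> g S = 0"
    using assms(2) by (auto simp: subset_degree_le_def)
  define h where "h U = (\<Sum>p | fst p \<union> snd p = U. f (fst p) * g (snd p))" for U
  show ?thesis
    unfolding subset_degree_le_def
  proof (intro exI[of _ h] conjI allI impI)
    fix S :: "'a set" assume S: "finite S"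
    have "F S * G S = (\<Sum>p\<in>Pow S \<times> Pow S. f (fst p) * g (snd p))"
      by (simp add: f(1)[OF S] g(1)[OF S] sum_product sum.cartesian_product case_prod_unfold)
    also have "\<dots> = (\<Sum>U\<in>Pow S. \<Sum>p | p \<in> Pow S \<times> Pow S \<and> fst p \<union> snd p = U. f (fst p) * g (snd p))"
      by (rule sum.group[symmetric]) (use S in auto)
    also have "\<dots> = (\<Sum>U\<in>Pow S. h U)"
      unfolding h_def by (intro sum.cong refl) auto
    finally show "F S * G S = sum h (Pow S)" .
  next
    fix S :: "'a set" assume S: "finite S \<and> d + e < card S"
    have "f A * g B = 0" if "A \<union> B = S" for A B
    proof -
      have "finite A" "finite B" using that S by auto
      moreover have "card S \<le> card A + card B" using card_Un_le[of A B] that by simp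
      then have "d < card A \<or> e < card B" using S by linarith
      ultimately show ?thesis using f(2) g(2) by auto
    qed
    then show "h S = 0" unfolding h_def by (intro sum.neutral) auto
  qed
qed

lemma subset_degree_le_power:
  "subset_degree_le d F \<Longrightarrow> subset_degree_le (r * d) (\<lambda>S. F S ^ r)"
proof (induction r)
  case 0
  then show ?case by (simp add: subset_degree_le_one)
next
  case (Suc r)
  then show ?case using subset_degree_le_mult[of d F "r * d" "\<lambda>S. F S ^ r"] by simp
qed

lemma subset_degree_le_prod:
  "finite I \<Longrightarrow> (\<And>i. i \<in> I \<Longrightarrow> subset_degree_le (d i) (F i)) \<Longrightarrow> subset_degree_le (sum d I) (\<lambda>S. \<Prod>i\<in>I. F i S)"
  by (induction I rule: finite_induct) (auto simp: subset_degree_le_one intro: subset_degree_le_mult)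

definition moebius_transform :: "('a set \<Rightarrow> 'b::comm_ring_1) \<Rightarrow> 'a set \<Rightarrow> 'b" where
  "moebius_transform F S = (\<Sum>T\<in>Pow S. (- 1) ^ (card S - card T) * F T)"

lemma subset_degree_le_expansion:
  assumes "subset_degree_le d F" "finite S"
  shows "F S = (\<Sum>T | T \<subseteq> S \<and> card T \<le> d. moebius_transform F T)"
proof -
  obtain f where f: "\<And>S. finite S \<Longrightarrow> F S = sum f (Pow S)" "\<And>S. finite S \<Longrightarrow> d < card S \<Longrightarrow> f S = 0"
    using assms(1) by (auto simp: subset_degree_le_def)
  have "f T = moebius_transform F T" if "finite T" for T
    unfolding moebius_transform_def using f(1) that by (rule inclusion_exclusion_mobius)
  then have "f T = moebius_transform F T" if "T \<subseteq> S" for T using that assms(2) finite_subset by blast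
  then have "F S = (\<Sum>T\<in>Pow S. moebius_transform F T)" unfolding f(1)[OF assms(2)] by (intro sum.cong) auto
  also have "\<dots> = (\<Sum>T | T \<subseteq> S \<and> card T \<le> d. moebius_transform F T)"
  proof (rule sum.mono_neutral_right)
    show "\<forall>T\<in>Pow S - {T. T \<subseteq> S \<and> card T \<le> d}. moebius_transform F T = 0"
    proof
      fix T assume "T \<in> Pow S - {T. T \<subseteq> S \<and> card T \<le> d}"
      then have "T \<subseteq> S" "d < card T" by auto
      moreover from this have "finite T" using assms(2) finite_subset by blast
      ultimately show "moebius_transform F T = 0" using f(2) \<open>\<And>T. finite T \<Longrightarrow> f T = moebius_transform F T\<close> by metis
    qed
  qed (use assms(2) in auto)
  finally show ?thesis .
qed

section \<open>Polynomial statistics of an exchangeable array\<close>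

text \<open>
  After division by \<open>N ^ L\<close> only the binomial coefficients of full order \<open>L\<close> survive.
\<close>
lemma binomial_over_power_limit:
  assumes "s \<le> L"
  shows "(\<lambda>N. of_nat (N choose s) / of_nat N ^ L :: complex) \<longlonglongrightarrow> (if s = L then 1 / fact L else 0)"
proof -
  have "(\<lambda>n. (real ((s + n) choose n) / real (n ^ s)) * (real n / (real n + real s)) ^ s) \<longlonglongrightarrow> 1 / fact s * 1 ^ s"
  proof (intro tendsto_mult tendsto_power)
    show "(\<lambda>n. real ((s + n) choose n) / real (n ^ s)) \<longlonglongrightarrow> 1 / fact s"
      using fact_binomial_limit[of s, where 'a = real] by simp
    show "(\<lambda>n. real n / (real n + real s)) \<longlonglongrightarrow> 1" by real_asymp
  qed
  moreover have "\<forall>\<^sub>F n in sequentially. (real ((s + n) choose n) / real (n ^ s)) * (real n / (real n + real s)) ^ s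
      = real ((n + s) choose s) / real (n + s) ^ s"
    using eventually_gt_at_top[of 0]
  proof eventually_elim
    case (elim n)
    have "(s + n) choose n = (n + s) choose s" using binomial_symmetric[of n "n + s"] by (simp add: add.commute)
    then show ?case using elim by (simp add: power_divide)
  qed
  ultimately have "(\<lambda>n. real ((n + s) choose s) / real (n + s) ^ s) \<longlonglongrightarrow> 1 / fact s"
    using Lim_transform_eventually by fastforce
  then have "(\<lambda>N. real (N choose s) / real N ^ s) \<longlonglongrightarrow> 1 / fact s"
    by (rule LIMSEQ_offset)
  then have *: "(\<lambda>N. (real (N choose s) / real N ^ s) * (1 / real N) ^ (L - s)) \<longlonglongrightarrow> 1 / fact s * 0 ^ (L - s)"
    by (intro tendsto_mult tendsto_power lim_1_over_n)
  have "real (N choose s) / real N ^ s * (1 / real N) ^ (L - s) = real (N choose s) / real N ^ L" for N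
  proof -
    have "real N ^ L = real N ^ s * real N ^ (L - s)" using assms by (simp flip: power_add)
    then show ?thesis by (simp add: power_divide)
  qed
  with * have "(\<lambda>N. real (N choose s) / real N ^ L) \<longlonglongrightarrow> 1 / fact s * 0 ^ (L - s)" by simp
  then have "(\<lambda>N. complex_of_real (real (N choose s) / real N ^ L)) \<longlonglongrightarrow> complex_of_real (1 / fact s * 0 ^ (L - s))"
    by (rule tendsto_of_real)
  then show ?thesis using assms by (cases "s = L") (simp_all add: zero_power)
qed

lemma ex_permutes_image_eq:
  assumes "S \<subseteq> {..<n::nat}"
  shows "\<exists>\<rho>. \<rho> permutes {..<n} \<and> \<rho> ` {..<card S} = S"
proof -
  have fin: "finite S" using assms finite_subset by blast
  have le: "card S \<le> n" using card_mono[OF _ assms] by simp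
  obtain f where f: "bij_betw f {..<card S} S"
    using ex_bij_betw_nat_finite[OF fin] by (auto simp: atLeast0LessThan)
  have "card ({..<n} - {..<card S}) = card ({..<n} - S)"
    using le assms fin by (simp add: card_Diff_subset)
  then obtain g where g: "bij_betw g ({..<n} - {..<card S}) ({..<n} - S)"
    using bij_betw_iff_card by (metis finite_Diff finite_lessThan)
  let ?h = "\<lambda>i. if i \<in> {..<card S} then f i else g i"
  have "bij_betw ?h ({..<card S} \<union> ({..<n} - {..<card S})) (S \<union> ({..<n} - S))"
  proof (rule bij_betw_combine)
    show "bij_betw ?h {..<card S} S" using f by (subst bij_betw_cong[of _ _ f]) auto
    show "bij_betw ?h ({..<n} - {..<card S}) ({..<n} - S)" using g by (subst bij_betw_cong[of _ _ g]) auto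
  qed auto
  moreover have "{..<card S} \<union> ({..<n} - {..<card S}) = {..<n}" "S \<union> ({..<n} - S) = {..<n}"
    using le assms by auto
  ultimately have h: "bij_betw ?h {..<n} {..<n}" by (simp only:)
  let ?\<rho> = "\<lambda>i. if i \<in> {..<n} then ?h i else i"
    \<comment> \<open>Any bijection between the complements completes the bijection from \<open>{..<card S}\<close> to \<open>S\<close>.\<close>
have "?\<rho> permutes {..<n}"
  proof (rule bij_imp_permutes)
    show "bij_betw ?\<rho> {..<n} {..<n}" using h by (subst bij_betw_cong[of _ _ ?h]) auto
  qed simp
  moreover have "?\<rho> ` {..<card S} = f ` {..<card S}" using le by (intro image_cong) auto
  then have "?\<rho> ` {..<card S} = S" using f by (simp add: bij_betw_def)
  ultimately show ?thesis by blast
qed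

lemma bij_betw_image_layer:
  assumes "\<tau> permutes {..<n}" "S \<subseteq> {..<n}"
  shows "bij_betw ((`) \<tau>) {T. T \<subseteq> S \<and> card T = k} {T. T \<subseteq> \<tau> ` S \<and> card T = k}"
  unfolding bij_betw_def
proof
  have inj: "inj_on \<tau> T" for T using permutes_inj[OF assms(1)] inj_on_subset by blast
  show "inj_on ((`) \<tau>) {T. T \<subseteq> S \<and> card T = k}"
    using inj_on_image_Pow[OF inj[of S]] by (rule inj_on_subset) auto
  show "(`) \<tau> ` {T. T \<subseteq> S \<and> card T = k} = {T. T \<subseteq> \<tau> ` S \<and> card T = k}"
    using card_image[OF inj] by (auto simp: subset_image_iff)
qed

context symmetric_prob_space
begin

text \<open>
  Compatibility with relabelling, as for the principal minors of an array. It reduces statements about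
  an arbitrary finite index set to an initial segment of the same size.
\<close>
definition equivariant :: "(nat set \<Rightarrow> 'a \<Rightarrow> 'b) \<Rightarrow> bool" where
  "equivariant f \<longleftrightarrow> (\<forall>n \<tau> S x. \<tau> permutes {..<n} \<and> S \<subseteq> {..<n} \<longrightarrow> f (\<tau> ` S) x = f S (act \<tau> x))"

lemma equivariantD:
  "equivariant f \<Longrightarrow> \<tau> permutes {..<n} \<Longrightarrow> S \<subseteq> {..<n} \<Longrightarrow> f (\<tau> ` S) x = f S (act \<tau> x)"
  unfolding equivariant_def by blast

lemma avg_act_inside:
  assumes "\<rho> permutes {..<n}"
  shows "avg n (\<lambda>x. f (act \<rho> x)) x = avg n f x"
  using sum_permutations_compose_right[OF assms, of "\<lambda>\<tau>. f (act \<tau> x)"]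
  by (simp add: avg_def act_act)

text \<open>
  The sum over all \<open>k\<close>-subsets is invariant, so it equals its own average; and the averages of the
  single summands coincide, because any two \<open>k\<close>-subsets are related by a permutation.
\<close>
lemma sum_layer_eq_avg:
  fixes f :: "nat set \<Rightarrow> 'a \<Rightarrow> complex"
  assumes f: "equivariant f"
  shows "(\<Sum>S | S \<subseteq> {..<n} \<and> card S = k. f S x) = of_nat (n choose k) * avg n (f {..<k}) x"
proof -
  let ?L = "{S. S \<subseteq> {..<n} \<and> card S = k}"
  have "(\<Sum>S\<in>?L. f S x) = avg n (\<lambda>x. \<Sum>S\<in>?L. f S x) x"
  proof (rule avg_of_invariant[symmetric])
    fix \<tau> assume \<tau>: "\<tau> permutes {..<n}"
    have "(\<Sum>S\<in>?L. f S (act \<tau> x)) = (\<Sum>S\<in>?L. f (\<tau> ` S) x)"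
      by (intro sum.cong refl) (use equivariantD[OF f \<tau>] in auto)
    also have "\<dots> = (\<Sum>S\<in>?L. f S x)"
      using sum.reindex_bij_betw[OF bij_betw_image_layer[OF \<tau> order.refl], of "\<lambda>S. f S x" k]
      by (simp add: permutes_image[OF \<tau>])
    finally show "(\<Sum>S\<in>?L. f S (act \<tau> x)) = (\<Sum>S\<in>?L. f S x)" .
  qed
  also have "\<dots> = (\<Sum>S\<in>?L. avg n (f S) x)" by (rule avg_sum)
  also have "\<dots> = (\<Sum>S\<in>?L. avg n (f {..<k}) x)"
  proof (rule sum.cong[OF refl])
    fix S assume "S \<in> ?L"
    then have S: "S \<subseteq> {..<n}" "card S = k" by auto
    then have "k \<le> n" using card_mono[OF _ S(1)] by simp
    obtain \<rho> where \<rho>: "\<rho> permutes {..<n}" "\<rho> ` {..<k} = S" using ex_permutes_image_eq[OF S(1)] S(2) by blast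
    have "f S = (\<lambda>x. f {..<k} (act \<rho> x))"
      using equivariantD[OF f \<rho>(1), of "{..<k}"] \<rho>(2) \<open>k \<le> n\<close> by auto
    then show "avg n (f S) x = avg n (f {..<k}) x" using avg_act_inside[OF \<rho>(1)] by simp
  qed
  also have "\<dots> = of_nat (n choose k) * avg n (f {..<k}) x"
    using n_subsets[of "{..<n}" k] by simp
  finally show ?thesis .
qed

lemma
  fixes f :: "nat set \<Rightarrow> 'a \<Rightarrow> complex"
  assumes f: "equivariant f" and S: "finite S" and int: "integrable M (f {..<card S})"
  shows integrable_equivariant: "integrable M (f S)"
    and integral_equivariant: "(\<integral>x. f S x \<partial>M) = (\<integral>x. f {..<card S} x \<partial>M)"
proof -
  obtain n where n: "S \<subseteq> {..<n}" using finite_nat_iff_bounded S by blast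
  then have "card S \<le> n" using card_mono[OF _ n] by simp
  obtain \<rho> where \<rho>: "\<rho> permutes {..<n}" "\<rho> ` {..<card S} = S" using ex_permutes_image_eq[OF n] by blast
  have eq: "f S = (\<lambda>x. f {..<card S} (act \<rho> x))"
    using equivariantD[OF f \<rho>(1), of "{..<card S}"] \<rho>(2) \<open>card S \<le> n\<close> by auto
  show "integrable M (f S)" "(\<integral>x. f S x \<partial>M) = (\<integral>x. f {..<card S} x \<partial>M)"
    unfolding eq
    using integrable_distr[OF act_measurable[OF \<rho>(1)], of "f {..<card S}"]
      integral_distr[OF act_measurable[OF \<rho>(1)], of "f {..<card S}"] distr_act[OF \<rho>(1)] int by auto
qed

lemma equivariant_moebius:
  fixes F :: "nat set \<Rightarrow> 'a \<Rightarrow> 'b::comm_ring_1"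
  assumes "equivariant F"
  shows "equivariant (\<lambda>S x. moebius_transform (\<lambda>T. F T x) S)"
  unfolding equivariant_def
proof (intro allI impI, elim conjE)
  fix n \<tau> S x assume \<tau>: "\<tau> permutes {..<n::nat}" and S: "S \<subseteq> {..<n}"
  have inj: "inj_on \<tau> A" for A using permutes_inj[OF \<tau>] inj_on_subset by blast
  have "moebius_transform (\<lambda>T. F T x) (\<tau> ` S) = (\<Sum>T\<in>(`) \<tau> ` Pow S. (- 1) ^ (card (\<tau> ` S) - card T) * F T x)"
    by (simp add: moebius_transform_def image_Pow_surj)
  also have "\<dots> = (\<Sum>T\<in>Pow S. (- 1) ^ (card (\<tau> ` S) - card (\<tau> ` T)) * F (\<tau> ` T) x)"
    using inj_on_image_Pow[OF inj] by (subst sum.reindex) auto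
  also have "\<dots> = moebius_transform (\<lambda>T. F T (act \<tau> x)) S"
    unfolding moebius_transform_def using S
    by (intro sum.cong refl) (auto simp: card_image[OF inj] equivariantD[OF assms \<tau>])
  finally show "moebius_transform (\<lambda>T. F T x) (\<tau> ` S) = moebius_transform (\<lambda>T. F T (act \<tau> x)) S" .
qed

text \<open>
  A polynomial statistic is a combination of averages of its Moebius transforms, weighted by binomial
  coefficients. After division by \<open>N ^ L\<close> the limit is that of the term of top order. Its integral is
  the integral of the Moebius transform at \<open>{..<L}\<close>, in which all subsets of the same size \<open>m\<close>
  contribute equally.
\<close>
theorem polynomial_statistic_converges:
  fixes F :: "nat set \<Rightarrow> 'a \<Rightarrow> complex"
  assumes F: "equivariant F"
    and deg: "\<And>x. subset_degree_le L (\<lambda>S. F S x)"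
    and int: "\<And>m. m \<le> L \<Longrightarrow> integrable M (F {..<m})"
  obtains V where "integrable M V"
    and "AE x in M. (\<lambda>N. F {..<N} x / of_nat N ^ L) \<longlonglongrightarrow> V x"
    and "(\<integral>x. V x \<partial>M) =
      1 / fact L * (\<Sum>m\<le>L. (- 1) ^ (L - m) * of_nat (L choose m) * (\<integral>x. F {..<m} x \<partial>M))"
proof -
  define G where "G = (\<lambda>S x. moebius_transform (\<lambda>T. F T x) S)"
  have G: "equivariant G" unfolding G_def by (rule equivariant_moebius[OF F])
  have int_F: "integrable M (F T)" "(\<integral>x. F T x \<partial>M) = (\<integral>x. F {..<card T} x \<partial>M)"
    if "T \<subseteq> {..<s}" "s \<le> L" for T s
  proof -
    have T: "finite T" "card T \<le> L"
      using that finite_subset[of T "{..<s}"] card_mono[of "{..<s}" T] by auto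
    show "integrable M (F T)" "(\<integral>x. F T x \<partial>M) = (\<integral>x. F {..<card T} x \<partial>M)"
      using integrable_equivariant[OF F T(1) int[OF T(2)]] integral_equivariant[OF F T(1) int[OF T(2)]] by auto
  qed
  have int_G: "integrable M (G {..<s})" if "s \<le> L" for s
    unfolding G_def moebius_transform_def using int_F(1)[OF _ that] by auto
  have expansion: "F {..<N} x = (\<Sum>s\<le>L. of_nat (N choose s) * avg N (G {..<s}) x)" for N x
  proof -
    let ?A = "{T. T \<subseteq> {..<N} \<and> card T \<le> L}"
    have "F {..<N} x = (\<Sum>T\<in>?A. G T x)"
      unfolding G_def by (rule subset_degree_le_expansion[OF deg]) simp
    also have "\<dots> = (\<Sum>s\<le>L. \<Sum>T | T \<in> ?A \<and> card T = s. G T x)"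
      by (rule sum.group[symmetric]) (auto intro: finite_subset[of _ "Pow {..<N}"])
    also have "\<dots> = (\<Sum>s\<le>L. \<Sum>T | T \<subseteq> {..<N} \<and> card T = s. G T x)"
      by (intro sum.cong refl) auto
    finally show ?thesis by (simp add: sum_layer_eq_avg[OF G])
  qed
  have "\<forall>s\<in>{..L}. \<exists>V. integrable M V \<and> (AE x in M. (\<lambda>N. avg N (G {..<s}) x) \<longlonglongrightarrow> V x) \<and>
      (\<integral>x. V x \<partial>M) = (\<integral>x. G {..<s} x \<partial>M)"
  proof
    fix s assume "s \<in> {..L}"
    then have "s \<le> L" by simp
    from int_G[OF this] show "\<exists>V. integrable M V \<and> (AE x in M. (\<lambda>N. avg N (G {..<s}) x) \<longlonglongrightarrow> V x) \<and>
        (\<integral>x. V x \<partial>M) = (\<integral>x. G {..<s} x \<partial>M)"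
      by (rule avg_converges) blast
  qed
  then obtain V where V: "\<And>s. s \<le> L \<Longrightarrow> integrable M (V s)"
    "\<And>s. s \<le> L \<Longrightarrow> AE x in M. (\<lambda>N. avg N (G {..<s}) x) \<longlonglongrightarrow> V s x"
    "\<And>s. s \<le> L \<Longrightarrow> (\<integral>x. V s x \<partial>M) = (\<integral>x. G {..<s} x \<partial>M)"
    unfolding bchoice_iff by auto
  show ?thesis
  proof (rule that[of "\<lambda>x. 1 / fact L * V L x"])
    show "integrable M (\<lambda>x. 1 / fact L * V L x)" using V(1)[of L] by simp
    have "AE x in M. \<forall>s\<in>{..L}. (\<lambda>N. avg N (G {..<s}) x) \<longlonglongrightarrow> V s x"
      using V(2) by (intro AE_finite_allI) auto
    then show "AE x in M. (\<lambda>N. F {..<N} x / of_nat N ^ L) \<longlonglongrightarrow> 1 / fact L * V L x"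
    proof eventually_elim
      case (elim x)
      have "(\<lambda>N. \<Sum>s\<le>L. of_nat (N choose s) / of_nat N ^ L * avg N (G {..<s}) x)
          \<longlonglongrightarrow> (\<Sum>s\<le>L. (if s = L then 1 / fact L else 0) * V s x)"
        using elim by (intro tendsto_sum tendsto_mult binomial_over_power_limit) auto
      moreover have "(\<Sum>s\<le>L. (if s = L then 1 / fact L else 0) * V s x) = 1 / fact L * V L x"
        by (simp add: if_distrib[of "\<lambda>c. c * _"] sum.delta cong: if_cong)
      moreover have "F {..<N} x / of_nat N ^ L = (\<Sum>s\<le>L. of_nat (N choose s) / of_nat N ^ L * avg N (G {..<s}) x)" for N
        unfolding expansion sum_divide_distrib by simp
      ultimately show ?case by simp
    qed
    have "(\<integral>x. G {..<L} x \<partial>M) = (\<Sum>T\<in>Pow {..<L}. (- 1) ^ (L - card T) * (\<integral>x. F {..<card T} x \<partial>M))"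
      unfolding G_def moebius_transform_def using int_F[OF _ order.refl] by (auto intro!: sum.cong)
    also have "\<dots> = (\<Sum>m\<le>L. \<Sum>T | T \<in> Pow {..<L} \<and> card T = m. (- 1) ^ (L - card T) * (\<integral>x. F {..<card T} x \<partial>M))"
    proof (rule sum.group[symmetric])
      show "card ` Pow {..<L} \<subseteq> {..L}" using card_mono[of "{..<L}"] by fastforce
    qed auto
    also have "\<dots> = (\<Sum>m\<le>L. (- 1) ^ (L - m) * of_nat (L choose m) * (\<integral>x. F {..<m} x \<partial>M))"
      using n_subsets[of "{..<L}"] by (intro sum.cong refl) simp
    finally show "(\<integral>x. 1 / fact L * V L x \<partial>M) =
        1 / fact L * (\<Sum>m\<le>L. (- 1) ^ (L - m) * of_nat (L choose m) * (\<integral>x. F {..<m} x \<partial>M))"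
      using V(3)[of L] by simp
  qed
qed

end

section \<open>Convergence of moments\<close>

text \<open>
  The case of a vanishing argument completes the convexity on the positive half-line: there the
  claim is that \<open>t powr p \<le> t\<close> for \<open>t\<close> between 0 and 1.
\<close>
lemma convex_on_powr_nonneg:
  fixes p :: real
  assumes "p \<ge> 1"
  shows "convex_on {0..} (\<lambda>x. x powr p)"
proof (rule convex_onI)
  have scaled: "(t * x) powr p \<le> t * x powr p" if "0 < t" "t < 1" "0 \<le> x" for t x :: real
  proof -
    have "t powr p \<le> t powr 1" using that assms by (intro powr_mono') auto
    then show ?thesis using that by (simp add: powr_mult mult_right_mono)
  qed
  fix t x y :: real
  assume t: "0 < t" "t < 1" and xy: "x \<in> {0..}" "y \<in> {0..}"
  show "((1 - t) *\<^sub>R x + t *\<^sub>R y) powr p \<le> (1 - t) * x powr p + t * y powr p"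
  proof (cases "x = 0 \<or> y = 0")
    case True
    then show ?thesis using scaled[of t y] scaled[of "1 - t" x] t xy assms by auto
  next
    case False
    then show ?thesis using convex_onD[OF powr_convex[OF assms], of t x y] t xy by auto
  qed
qed (rule convex_real_interval)

lemma powr_norm_diff_le:
  fixes a b :: "'b::real_normed_vector"
  assumes "p \<ge> 0"
  shows "norm (a - b) powr p \<le> 2 powr p * (norm a powr p + norm b powr p)"
proof -
  let ?m = "max (norm a) (norm b)"
  have "norm (a - b) \<le> 2 * ?m" using norm_triangle_ineq4[of a b] by linarith
  then have "norm (a - b) powr p \<le> (2 * ?m) powr p" using assms by (intro powr_mono2) auto
  also have "\<dots> = 2 powr p * ?m powr p" by (simp add: powr_mult)
  also have "\<dots> \<le> 2 powr p * (norm a powr p + norm b powr p)"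
    by (intro mult_left_mono) (auto simp: max_def)
  finally show ?thesis .
qed

lemma tendsto_rpow:
  assumes "(f \<longlongrightarrow> x) F" "\<And>n. 0 \<le> f n" "0 \<le> r"
  shows "((\<lambda>n. rpow (f n) r) \<longlongrightarrow> rpow x r) F"
  using assms by (auto simp: rpow_def intro!: tendsto_powr')

text \<open>Every base is at most the largest one, whose \<open>p\<close>-th power is one of the summands.\<close>
lemma prod_rpow_le_sum_powr:
  assumes fin: "finite A" and x: "\<And>k. k \<in> A \<Longrightarrow> 0 \<le> x k" and r: "\<And>k. k \<in> A \<Longrightarrow> 0 \<le> r k"
    and sum: "sum r A = p" and "0 < p"
  shows "(\<Prod>k\<in>A. rpow (x k) (r k)) \<le> (\<Sum>k\<in>A. x k powr p)"
proof -
  define m where "m = Max (x ` A)"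
  have "A \<noteq> {}" using sum \<open>0 < p\<close> by auto
  then have "m \<in> x ` A" unfolding m_def using fin by (intro Max_in) auto
  then obtain k0 where k0: "k0 \<in> A" "m = x k0" by auto
  have le_m: "x k \<le> m" if "k \<in> A" for k unfolding m_def using fin that by (intro Max_ge) auto
  have "0 \<le> m" using k0 x by auto
  have "(\<Prod>k\<in>A. rpow (x k) (r k)) \<le> (\<Prod>k\<in>A. rpow m (r k))"
  proof (rule prod_mono)
    fix k assume "k \<in> A"
    then show "0 \<le> rpow (x k) (r k) \<and> rpow (x k) (r k) \<le> rpow m (r k)"
      using x r le_m by (auto simp: rpow_def intro: powr_mono2)
  qed
  also have "\<dots> = m powr p"
  proof (cases "m = 0")
    case True
    obtain k where "k \<in> A" "r k \<noteq> 0" using sum \<open>0 < p\<close> by (metis less_irrefl sum.neutral)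
    then have "(\<Prod>k\<in>A. rpow m (r k)) = 0" using fin True by (intro prod_zero) (auto simp: rpow_def)
    then show ?thesis using True by simp
  next
    case False
    then have "rpow m s = m powr s" for s by (simp add: rpow_def)
    then show ?thesis using False powr_sum[OF False, of r A] sum by simp
  qed
  also have "\<dots> \<le> (\<Sum>k\<in>A. x k powr p)"
    unfolding k0(2) using fin k0(1) by (intro member_le_sum) auto
  finally show ?thesis .
qed

text \<open>
  The same comparison when the total exponent is only bounded by \<open>p\<close>: the largest base is replaced by
  its maximum with 1, so that raising the exponent increases the power.
\<close>
lemma prod_power_le_sum_powr:
  fixes x :: "'i \<Rightarrow> real" and r :: "'i \<Rightarrow> nat"
  assumes fin: "finite A" and x: "\<And>j. j \<in> A \<Longrightarrow> 0 \<le> x j" and r: "real (sum r A) \<le> p"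
  shows "(\<Prod>j\<in>A. x j ^ r j) \<le> 1 + (\<Sum>j\<in>A. x j powr p)"
proof -
  define m where "m = Max (insert 1 (x ` A))"
  have m_cases: "m = 1 \<or> (\<exists>j\<in>A. m = x j)"
    using Max_in[of "insert 1 (x ` A)"] fin by (auto simp: m_def)
  have m: "1 \<le> m" "\<And>j. j \<in> A \<Longrightarrow> x j \<le> m" unfolding m_def using fin by (auto intro: Max_ge)
  have "(\<Prod>j\<in>A. x j ^ r j) \<le> (\<Prod>j\<in>A. m ^ r j)"
    using x m(2) by (intro prod_mono) (auto intro: power_mono)
  also have "\<dots> = m powr real (sum r A)" using m(1) by (subst powr_realpow) (auto simp: power_sum)
  also have "\<dots> \<le> m powr p" using m(1) r by (intro powr_mono) auto
  also have "\<dots> \<le> 1 + (\<Sum>j\<in>A. x j powr p)"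
    using m_cases
  proof
    assume "m = 1"
    then show ?thesis by (simp add: sum_nonneg)
  next
    assume "\<exists>j\<in>A. m = x j"
    then obtain j where j: "j \<in> A" "m = x j" by blast
    have "x j powr p \<le> (\<Sum>j\<in>A. x j powr p)" using fin j(1) by (intro member_le_sum) auto
    then show ?thesis using j by simp
  qed
  finally show ?thesis .
qed

text \<open>
  The sequence \<open>u\<close> tends to \<open>v\<close> almost everywhere, and its \<open>p\<close>-th powers have majorants \<open>G\<close> with limit
  \<open>g\<close> to which dominated convergence with varying majorants applies. Keeping the majorants explicit
  allows them to be added up for products of several sequences.
\<close>
definition powr_majorized :: "'a measure \<Rightarrow> real \<Rightarrow> (nat \<Rightarrow> 'a \<Rightarrow> complex) \<Rightarrow> ('a \<Rightarrow> complex) \<Rightarrow>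
    (nat \<Rightarrow> 'a \<Rightarrow> real) \<Rightarrow> ('a \<Rightarrow> real) \<Rightarrow> bool" where
  "powr_majorized M p u v G g \<longleftrightarrow>
     (\<forall>n. u n \<in> borel_measurable M) \<and> v \<in> borel_measurable M \<and>
     (AE x in M. (\<lambda>n. u n x) \<longlonglongrightarrow> v x) \<and>
     (\<forall>n. integrable M (G n)) \<and> integrable M g \<and> (AE x in M. (\<lambda>n. G n x) \<longlonglongrightarrow> g x) \<and>
     (\<lambda>n. \<integral>x. G n x \<partial>M) \<longlonglongrightarrow> (\<integral>x. g x \<partial>M) \<and>
     (\<forall>n x. cmod (u n x) powr p \<le> G n x)"

text \<open>The powers \<open>cmod (u n - v) powr p\<close> have the majorants \<open>2 powr p * (G n + cmod v powr p)\<close>.\<close>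
lemma powr_majorized_tendsto_Lp:
  assumes "powr_majorized M p u v G g" and "p > 0"
  shows "tendsto_Lp M p u v"
proof -
  have [measurable]: "\<And>n. u n \<in> borel_measurable M" "v \<in> borel_measurable M"
    and lim: "AE x in M. (\<lambda>n. u n x) \<longlonglongrightarrow> v x"
    and G: "\<And>n. integrable M (G n)" and g: "integrable M g"
    and G_lim: "AE x in M. (\<lambda>n. G n x) \<longlonglongrightarrow> g x"
    and int_lim: "(\<lambda>n. \<integral>x. G n x \<partial>M) \<longlonglongrightarrow> (\<integral>x. g x \<partial>M)"
    and bound: "\<And>n x. cmod (u n x) powr p \<le> G n x"
    using assms(1) by (auto simp: powr_majorized_def)
  have lim_powr: "AE x in M. (\<lambda>n. cmod (u n x) powr p) \<longlonglongrightarrow> cmod (v x) powr p"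
    using lim by eventually_elim (use \<open>p > 0\<close> in \<open>auto intro!: tendsto_powr' tendsto_norm\<close>)
  have Lp: "integrable M (\<lambda>x. cmod (v x) powr p)" "\<And>n. integrable M (\<lambda>x. cmod (u n x) powr p)"
    by (rule generalized_dominated_convergence(1,2)[of "\<lambda>n x. cmod (u n x) powr p" _ _ G g];
        use G g lim_powr G_lim int_lim bound in simp)+
  have "(\<lambda>n. \<integral>x. cmod (u n x - v x) powr p \<partial>M) \<longlonglongrightarrow> (\<integral>x. 0 \<partial>M)"
  proof (rule generalized_dominated_convergence(3)[where
        G = "\<lambda>n x. 2 powr p * (G n x + cmod (v x) powr p)" and g = "\<lambda>x. 2 powr p * (g x + cmod (v x) powr p)"])
    show "AE x in M. (\<lambda>n. cmod (u n x - v x) powr p) \<longlonglongrightarrow> 0"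
      using lim
    proof eventually_elim
      case (elim x)
      then have "(\<lambda>n. cmod (u n x - v x) powr p) \<longlonglongrightarrow> cmod (v x - v x) powr p"
        using \<open>p > 0\<close> by (intro tendsto_powr' tendsto_norm tendsto_diff) auto
      then show ?case by simp
    qed
    show "AE x in M. (\<lambda>n. 2 powr p * (G n x + cmod (v x) powr p)) \<longlonglongrightarrow> 2 powr p * (g x + cmod (v x) powr p)"
      using G_lim by eventually_elim (intro tendsto_intros)
    show "AE x in M. norm (cmod (u n x - v x) powr p) \<le> 2 powr p * (G n x + cmod (v x) powr p)" for n
    proof (intro AE_I2)
      fix x
      have "cmod (u n x - v x) powr p \<le> 2 powr p * (cmod (u n x) powr p + cmod (v x) powr p)"
        using \<open>p > 0\<close> by (intro powr_norm_diff_le) simp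
      also have "\<dots> \<le> 2 powr p * (G n x + cmod (v x) powr p)"
        using bound[of n x] by (intro mult_left_mono add_right_mono) auto
      finally show "norm (cmod (u n x - v x) powr p) \<le> 2 powr p * (G n x + cmod (v x) powr p)" by simp
    qed
    have "(\<lambda>n. 2 powr p * ((\<integral>x. G n x \<partial>M) + (\<integral>x. cmod (v x) powr p \<partial>M)))
        \<longlonglongrightarrow> 2 powr p * ((\<integral>x. g x \<partial>M) + (\<integral>x. cmod (v x) powr p \<partial>M))"
      by (intro tendsto_intros int_lim)
    then show "(\<lambda>n. \<integral>x. 2 powr p * (G n x + cmod (v x) powr p) \<partial>M)
        \<longlonglongrightarrow> (\<integral>x. 2 powr p * (g x + cmod (v x) powr p) \<partial>M)"
      using G g Lp by simp
  qed (use G g Lp in auto)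
  then have "(\<lambda>n. (\<integral>x. cmod (u n x - v x) powr p \<partial>M) powr (1 / p)) \<longlonglongrightarrow> 0 powr (1 / p)"
    using \<open>p > 0\<close> by (intro tendsto_powr') auto
  then show ?thesis
    using Lp by (simp add: tendsto_Lp_def Lp_fun_def Lp_norm_def)
qed

lemma powr_majorized_prod_rpow:
  assumes fin: "finite I" and maj: "\<And>k. k \<in> I \<Longrightarrow> powr_majorized M p (\<lambda>n. u n k) (v k) (G k) (g k)"
    and r: "\<And>k. k \<in> I \<Longrightarrow> 0 \<le> r k" and sum: "sum r I = p" and "p > 0"
  shows "integrable M (\<lambda>x. \<Prod>k\<in>I. rpow (cmod (v k x)) (r k))"
    and "\<And>n. integrable M (\<lambda>x. \<Prod>k\<in>I. rpow (cmod (u n k x)) (r k))"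
    and "(\<lambda>n. \<integral>x. (\<Prod>k\<in>I. rpow (cmod (u n k x)) (r k)) \<partial>M)
      \<longlonglongrightarrow> (\<integral>x. (\<Prod>k\<in>I. rpow (cmod (v k x)) (r k)) \<partial>M)"
proof -
  have meas: "(\<lambda>x. \<Prod>k\<in>I. rpow (cmod (w k x)) (r k)) \<in> borel_measurable M"
    if "\<And>k. k \<in> I \<Longrightarrow> w k \<in> borel_measurable M" for w
    unfolding rpow_def by (intro borel_measurable_prod) (use that in auto)
  have m: "(\<lambda>x. \<Prod>k\<in>I. rpow (cmod (u n k x)) (r k)) \<in> borel_measurable M"
    "(\<lambda>x. \<Prod>k\<in>I. rpow (cmod (v k x)) (r k)) \<in> borel_measurable M" for n
    using maj by (auto intro!: meas simp: powr_majorized_def)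
  have G: "integrable M (\<lambda>x. \<Sum>k\<in>I. G k n x)" and g: "integrable M (\<lambda>x. \<Sum>k\<in>I. g k x)" for n
    using maj by (auto intro!: Bochner_Integration.integrable_sum simp: powr_majorized_def)
  have "AE x in M. \<forall>k\<in>I. (\<lambda>n. u n k x) \<longlonglongrightarrow> v k x"
    using maj fin by (intro AE_finite_allI) (auto simp: powr_majorized_def)
  then have lim: "AE x in M. (\<lambda>n. \<Prod>k\<in>I. rpow (cmod (u n k x)) (r k)) \<longlonglongrightarrow> (\<Prod>k\<in>I. rpow (cmod (v k x)) (r k))"
    by eventually_elim (use r in \<open>auto intro!: tendsto_prod tendsto_rpow tendsto_norm\<close>)
  have "AE x in M. \<forall>k\<in>I. (\<lambda>n. G k n x) \<longlonglongrightarrow> g k x"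
    using maj fin by (intro AE_finite_allI) (auto simp: powr_majorized_def)
  then have G_lim: "AE x in M. (\<lambda>n. \<Sum>k\<in>I. G k n x) \<longlonglongrightarrow> (\<Sum>k\<in>I. g k x)"
    by eventually_elim (auto intro!: tendsto_sum)
  have bound: "AE x in M. norm (\<Prod>k\<in>I. rpow (cmod (u n k x)) (r k)) \<le> (\<Sum>k\<in>I. G k n x)" for n
  proof (intro AE_I2)
    fix x
    have "(\<Prod>k\<in>I. rpow (cmod (u n k x)) (r k)) \<le> (\<Sum>k\<in>I. cmod (u n k x) powr p)"
      by (rule prod_rpow_le_sum_powr[OF fin _ r sum \<open>p > 0\<close>]) auto
    also have "\<dots> \<le> (\<Sum>k\<in>I. G k n x)"
      using maj by (intro sum_mono) (auto simp: powr_majorized_def)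
    finally show "norm (\<Prod>k\<in>I. rpow (cmod (u n k x)) (r k)) \<le> (\<Sum>k\<in>I. G k n x)"
      by (subst real_norm_def, subst abs_of_nonneg) (auto intro!: prod_nonneg simp: rpow_def)
  qed
  have int_lim: "(\<lambda>n. \<integral>x. (\<Sum>k\<in>I. G k n x) \<partial>M) \<longlonglongrightarrow> (\<integral>x. (\<Sum>k\<in>I. g k x) \<partial>M)"
  proof -
    have "(\<lambda>n. \<Sum>k\<in>I. \<integral>x. G k n x \<partial>M) \<longlonglongrightarrow> (\<Sum>k\<in>I. \<integral>x. g k x \<partial>M)"
      using maj by (intro tendsto_sum) (auto simp: powr_majorized_def)
    moreover have "(\<integral>x. (\<Sum>k\<in>I. G k n x) \<partial>M) = (\<Sum>k\<in>I. \<integral>x. G k n x \<partial>M)" for n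
      using maj by (intro Bochner_Integration.integral_sum) (auto simp: powr_majorized_def)
    moreover have "(\<integral>x. (\<Sum>k\<in>I. g k x) \<partial>M) = (\<Sum>k\<in>I. \<integral>x. g k x \<partial>M)"
      using maj by (intro Bochner_Integration.integral_sum) (auto simp: powr_majorized_def)
    ultimately show ?thesis by simp
  qed
  note gdc = generalized_dominated_convergence[of "\<lambda>n x. \<Prod>k\<in>I. rpow (cmod (u n k x)) (r k)" M,
      OF m(1) m(2) G g lim G_lim bound int_lim]
  show "integrable M (\<lambda>x. \<Prod>k\<in>I. rpow (cmod (v k x)) (r k))" by (rule gdc(1))
  show "integrable M (\<lambda>x. \<Prod>k\<in>I. rpow (cmod (u n k x)) (r k))" for n by (rule gdc(2))
  show "(\<lambda>n. \<integral>x. (\<Prod>k\<in>I. rpow (cmod (u n k x)) (r k)) \<partial>M)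
      \<longlonglongrightarrow> (\<integral>x. (\<Prod>k\<in>I. rpow (cmod (v k x)) (r k)) \<partial>M)" by (rule gdc(3))
qed

context symmetric_prob_space
begin

lemma norm_avg_powr_le:
  assumes "p \<ge> 1"
  shows "norm (avg n f x) powr p \<le> avg n (\<lambda>x. norm (f x) powr p) x"
proof -
  let ?P = "{\<tau>. \<tau> permutes {..<n}}"
  have avg_eq: "avg n g x = (\<Sum>\<tau>\<in>?P. (1 / fact n) *\<^sub>R g (act \<tau> x))" for g :: "'a \<Rightarrow> real"
    by (simp add: avg_def sum_divide_distrib inverse_eq_divide)
  have "norm (avg n f x) powr p \<le> (avg n (\<lambda>x. norm (f x)) x) powr p"
    using assms by (intro powr_mono2 norm_avg_le) auto
  also have "\<dots> \<le> (\<Sum>\<tau>\<in>?P. (1 / fact n) * norm (f (act \<tau> x)) powr p)"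
    unfolding avg_eq
    by (rule convex_on_sum[OF _ _ convex_on_powr_nonneg[OF assms]])
       (auto simp: card_perms intro: exI[of _ id])
  also have "\<dots> = avg n (\<lambda>x. norm (f x) powr p) x" by (simp add: avg_eq)
  finally show ?thesis .
qed

lemma integrable_of_integrable_powr:
  fixes f :: "'a \<Rightarrow> complex"
  assumes [measurable]: "f \<in> borel_measurable M" and "p \<ge> 1" and int: "integrable M (\<lambda>x. cmod (f x) powr p)"
  shows "integrable M f"
proof (rule Bochner_Integration.integrable_bound[of _ "\<lambda>x. 1 + cmod (f x) powr p"])
  have "cmod z \<le> 1 + cmod z powr p" for z
  proof (cases "cmod z \<le> 1")
    case False
    then have "cmod z powr 1 \<le> cmod z powr p" using \<open>p \<ge> 1\<close> by (intro powr_mono) auto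
    then show ?thesis by simp
  qed (simp add: add_increasing2)
  then show "AE x in M. norm (f x) \<le> norm (1 + cmod (f x) powr p)" by (auto simp: abs_of_nonneg)
qed (use int in auto)

text \<open>
  Up to the factors \<open>cmod (s n) powr p\<close>, the majorants are the averages of \<open>cmod f powr p\<close>: these
  converge almost surely, and their integrals are all equal to the integral of their limit.
\<close>
lemma powr_majorized_scaled_avg:
  fixes f :: "'a \<Rightarrow> complex" and s :: "nat \<Rightarrow> complex"
  assumes f: "f \<in> borel_measurable M" "integrable M (\<lambda>x. cmod (f x) powr p)" and "p \<ge> 1"
    and s: "s \<longlonglongrightarrow> c" and u: "\<And>n x. u n x = s n * avg n f x"
    and v: "v \<in> borel_measurable M" "\<And>x. v x = lim (\<lambda>n. u n x)"
  shows "\<exists>G g. powr_majorized M p u v G g"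
proof -
  obtain A where A: "AE x in M. (\<lambda>n. avg n f x) \<longlonglongrightarrow> A x"
    using avg_converges[OF integrable_of_integrable_powr[OF f(1) \<open>p \<ge> 1\<close> f(2)]] by blast
  obtain B where B: "integrable M B" "AE x in M. (\<lambda>n. avg n (\<lambda>x. cmod (f x) powr p) x) \<longlonglongrightarrow> B x"
    "(\<integral>x. B x \<partial>M) = (\<integral>x. cmod (f x) powr p \<partial>M)"
    using avg_converges_real[OF f(2)] by blast
  have s': "(\<lambda>n. cmod (s n) powr p) \<longlonglongrightarrow> cmod c powr p"
    using s \<open>p \<ge> 1\<close> by (auto intro!: tendsto_powr' tendsto_norm)
  let ?G = "\<lambda>n x. cmod (s n) powr p * avg n (\<lambda>x. cmod (f x) powr p) x"
  let ?g = "\<lambda>x. cmod c powr p * B x"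
  have "powr_majorized M p u v ?G ?g"
    unfolding powr_majorized_def
  proof (intro conjI allI)
    show "u n \<in> borel_measurable M" for n using f(1) by (subst measurable_cong[OF u]) simp
    show "v \<in> borel_measurable M" by (rule v(1))
    show "AE x in M. (\<lambda>n. u n x) \<longlonglongrightarrow> v x"
      using A
    proof eventually_elim
      case (elim x)
      have "(\<lambda>n. u n x) \<longlonglongrightarrow> c * A x" unfolding u by (intro tendsto_mult s elim)
      then show ?case unfolding v(2) by (metis limI)
    qed
    show "integrable M (?G n)" for n using integrable_avg[OF f(2)] by simp
    show "integrable M ?g" using B(1) by simp
    show "AE x in M. (\<lambda>n. ?G n x) \<longlonglongrightarrow> ?g x"
      using B(2) by eventually_elim (intro tendsto_mult s')
    have "(\<lambda>n. cmod (s n) powr p * (\<integral>x. cmod (f x) powr p \<partial>M)) \<longlonglongrightarrow> cmod c powr p * (\<integral>x. cmod (f x) powr p \<partial>M)"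
      by (intro tendsto_intros s')
    then show "(\<lambda>n. \<integral>x. ?G n x \<partial>M) \<longlonglongrightarrow> (\<integral>x. ?g x \<partial>M)"
      using integral_avg[OF f(2)] B(3) by simp
    show "cmod (u n x) powr p \<le> ?G n x" for n x
      unfolding u norm_mult using norm_avg_powr_le[OF \<open>p \<ge> 1\<close>, of n f x]
      by (simp add: powr_mult mult_left_mono)
  qed
  then show ?thesis by blast
qed

end

section \<open>Coefficients of an exchangeable Hermitian matrix\<close>

lemma relabel_relabel: "relabel \<sigma> (relabel \<tau> H) = relabel (\<tau> \<circ> \<sigma>) H"
  by (simp add: relabel_def)

lemma minor_sum_image:
  assumes \<tau>: "\<tau> permutes {..<n}" and S: "S \<subseteq> {..<n}"
  shows "minor_sum (\<tau> ` S) k H = minor_sum S k (relabel \<tau> H)"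
proof -
  have inj: "inj_on \<tau> T" for T using permutes_inj[OF \<tau>] inj_on_subset by blast
  have "minor_sum (\<tau> ` S) k H = (\<Sum>T | T \<subseteq> S \<and> card T = k. minor (\<tau> ` T) H)"
    unfolding minor_sum_def by (rule sum.reindex_bij_betw[OF bij_betw_image_layer[OF \<tau> S], symmetric])
  also have "\<dots> = minor_sum S k (relabel \<tau> H)"
    unfolding minor_sum_def
  proof (rule sum.cong[OF refl])
    fix T assume "T \<in> {T. T \<subseteq> S \<and> card T = k}"
    then have "finite T" using S by (auto intro: finite_subset)
    then show "minor (\<tau> ` T) H = minor T (relabel \<tau> H)" by (rule minor_image[OF _ inj])
  qed
  finally show ?thesis .
qed

text \<open>
  This also holds for \<open>N = 0\<close>, where both sides vanish because \<open>k \<ge> 1\<close>.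
\<close>
lemma minor_sum_lessThan_eq_rcoeff:
  assumes "k \<ge> 1"
  shows "minor_sum {..<N} k H = (- of_nat N) ^ k * rcoeff N k H"
proof (cases "N = 0")
  case True
  then have "{T. T \<subseteq> {..<N} \<and> card T = k} = {}" using assms by auto
  then have "minor_sum {..<N} k H = 0" by (simp only: minor_sum_def sum.empty)
  then show ?thesis using True assms by simp
next
  case False
  then show ?thesis by (simp add: rcoeff_eq_minor_sum power_mult_distrib[symmetric] mult.assoc[symmetric])
qed

lemma rcoeff_eq_0: "N < k \<Longrightarrow> rcoeff N k H = 0"
  unfolding rcoeff_def using degree_rev_char_poly[of N H] by (intro coeff_eq_0) simp

lemma measurable_entry: "(\<lambda>H. H i j) \<in> borel_measurable herm_inf"
proof -
  have "continuous_on UNIV (\<lambda>H :: nat \<Rightarrow> nat \<Rightarrow> complex. H i j)"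
    by (rule continuous_on_product_then_coordinatewise[OF continuous_on_product_coordinates])
  then show ?thesis
    unfolding herm_inf_def by (intro measurable_restrict_space1 borel_measurable_continuous_onI)
qed

lemma measurable_minor: "minor S \<in> borel_measurable herm_inf"
  unfolding minor_def using measurable_entry
  by (intro borel_measurable_sum borel_measurable_times borel_measurable_prod) auto

lemma measurable_rcoeff: "rcoeff N k \<in> borel_measurable herm_inf"
  unfolding rcoeff_eq_minor_sum[abs_def] minor_sum_def using measurable_minor
  by (intro borel_measurable_times borel_measurable_sum) auto

text \<open>
  Substituting \<open>\<tau>\<close> into the indices is conjugation with the permutation matrix of the inverse of \<open>\<tau>\<close>.
\<close>
lemma symmetric_prob_space_law:
  assumes P: "prob_space P" and X: "X \<in> P \<rightarrow>\<^sub>M herm_inf"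
    and exch: "\<And>\<tau>. bij \<tau> \<Longrightarrow> finite {i. \<tau> i \<noteq> i} \<Longrightarrow> law P X = law P (\<lambda>\<omega>. perm_conj \<tau> (X \<omega>))"
  shows "symmetric_prob_space (law P X) relabel"
proof -
  have relabel_eq: "relabel \<tau> = perm_conj (inv_into UNIV \<tau>)" if "bij \<tau>" for \<tau>
    using perm_conj_eq[OF bij_imp_bij_inv[OF that]] inv_inv_eq[OF that] by (auto simp: relabel_def)
  have meas: "relabel \<tau> \<in> herm_inf \<rightarrow>\<^sub>M herm_inf" if "bij \<tau>" for \<tau>
    unfolding relabel_eq[OF that] by (rule measurable_perm_conj[OF bij_imp_bij_inv[OF that]])
  interpret L: prob_space "law P X"
    unfolding law_def by (rule prob_space.prob_space_distr[OF P X])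
  show ?thesis
  proof
    fix \<tau> :: "nat \<Rightarrow> nat" and n assume \<tau>: "\<tau> permutes {..<n}"
    have bij: "bij \<tau>" by (rule permutes_bij[OF \<tau>])
    show "relabel \<tau> \<in> law P X \<rightarrow>\<^sub>M law P X"
      using meas[OF bij] by (simp add: law_def)
    have inv: "inv_into UNIV \<tau> permutes {..<n}" by (rule permutes_inv[OF \<tau>])
    have "{i. inv_into UNIV \<tau> i \<noteq> i} \<subseteq> {..<n}" using permutes_not_in[OF inv] by auto
    then have fin: "finite {i. inv_into UNIV \<tau> i \<noteq> i}" by (rule finite_subset) simp
    have "distr (law P X) (law P X) (relabel \<tau>) = distr (law P X) herm_inf (relabel \<tau>)"
      by (rule distr_cong) (auto simp: law_def)
    also have "\<dots> = law P (\<lambda>\<omega>. perm_conj (inv_into UNIV \<tau>) (X \<omega>))"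
      unfolding law_def using distr_distr[OF meas[OF bij] X] by (simp add: relabel_eq[OF bij] comp_def)
    also have "\<dots> = law P X" using exch[OF bij_imp_bij_inv[OF bij] fin] by simp
    finally show "distr (law P X) (law P X) (relabel \<tau>) = law P X" .
  qed (rule relabel_relabel)
qed

theorem theorem1p7:
  fixes P :: "'w measure" and X :: "'w \<Rightarrow> nat \<Rightarrow> nat \<Rightarrow> complex"
    and M :: nat and p :: real
  assumes "prob_space P"
    and "X \<in> P \<rightarrow>\<^sub>M herm_inf"
    and exchangeable: "\<And>\<tau>. bij \<tau> \<Longrightarrow> finite {i. \<tau> i \<noteq> i} \<Longrightarrow>
           law P X = law P (\<lambda>\<omega>. perm_conj \<tau> (X \<omega>))"
    and "M \<ge> 1" and "p \<ge> 1"
    and moments: "\<And>k. k \<in> {1..M} \<Longrightarrow>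
           integrable (law P X) (\<lambda>H. cmod (det (corner k H)) powr p)"
  shows "\<exists>a :: nat \<Rightarrow> (nat \<Rightarrow> nat \<Rightarrow> complex) \<Rightarrow> complex.
    (\<forall>k\<in>{1..M}.
        a k \<in> borel_measurable herm_inf \<and>
        tendsto_Lp (law P X) p (\<lambda>N. rcoeff N k) (a k) \<and>
        (AE H in law P X. (\<lambda>N. rcoeff N k H) \<longlonglongrightarrow> a k H)) \<and>
    (\<forall>r :: nat \<Rightarrow> real.
        (\<forall>k\<in>{1..M}. r k \<ge> 0) \<and> (\<Sum>k = 1..M. r k) = p \<longrightarrow>
        (\<forall>N. integrable (law P X) (\<lambda>H. \<Prod>k = 1..M. rpow (cmod (rcoeff N k H)) (r k))) \<and>
        integrable (law P X) (\<lambda>H. \<Prod>k = 1..M. rpow (cmod (a k H)) (r k)) \<and>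
        (\<lambda>N. \<integral>H. (\<Prod>k = 1..M. rpow (cmod (rcoeff N k H)) (r k)) \<partial>law P X)
          \<longlonglongrightarrow> (\<integral>H. (\<Prod>k = 1..M. rpow (cmod (a k H)) (r k)) \<partial>law P X)) \<and>
    (\<forall>(l :: nat) (r :: nat \<Rightarrow> nat) (k :: nat \<Rightarrow> nat) (L :: nat).
        l \<ge> 1 \<and> (\<forall>j\<in>{1..l}. r j \<ge> 1) \<and>
        (\<forall>i\<in>{1..l}. \<forall>j\<in>{1..l}. i < j \<longrightarrow> k i > k j) \<and> k 1 \<le> M \<and> k l \<ge> 1 \<and>
        L = (\<Sum>j = 1..l. r j * k j) \<longrightarrow>
        (real (\<Sum>j = 1..l. r j) \<le> p \<longrightarrow>
          (\<forall>m\<in>{k 1..L}. integrable (law P X) (\<lambda>H. \<Prod>j = 1..l. rcoeff m (k j) H ^ r j))) \<and>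
        ((\<forall>m\<in>{k 1..L}. integrable (law P X) (\<lambda>H. \<Prod>j = 1..l. rcoeff m (k j) H ^ r j)) \<longrightarrow>
          integrable (law P X) (\<lambda>H. \<Prod>j = 1..l. a (k j) H ^ r j) \<and>
          (\<integral>H. (\<Prod>j = 1..l. a (k j) H ^ r j) \<partial>law P X) =
            1 / fact L *
            (\<Sum>m = k 1..L. (- 1) ^ (m + L) * of_nat (L choose m) * of_nat m ^ L *
               (\<integral>H. (\<Prod>j = 1..l. rcoeff m (k j) H ^ r j) \<partial>law P X))))"
proof -
  let ?\<mu> = "law P X"
  interpret symmetric_prob_space ?\<mu> relabel
    by (rule symmetric_prob_space_law) (use assms(1,2) exchangeable in auto)
  have sets_law: "sets ?\<mu> = sets herm_inf" by (simp add: law_def)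
  have meas_law: "f \<in> borel_measurable ?\<mu>" if "f \<in> borel_measurable herm_inf"
    for f :: "(nat \<Rightarrow> nat \<Rightarrow> complex) \<Rightarrow> complex"
    using that measurable_cong_sets[OF sets_law refl] by blast
  have equivariant_minor: "equivariant minor"
    unfolding equivariant_def
    using minor_image permutes_inj inj_on_subset[OF _ subset_UNIV] finite_subset[OF _ finite_lessThan] by metis

  define a where "a k H = lim (\<lambda>N. rcoeff N k H)" for k H
  have a_meas: "a k \<in> borel_measurable herm_inf" for k
    unfolding a_def[abs_def] by (intro borel_measurable_lim_metric measurable_rcoeff)
  define s :: "nat \<Rightarrow> nat \<Rightarrow> complex" where "s k N = (- 1 / of_nat N) ^ k * of_nat (N choose k)" for k N
  have rcoeff_avg: "rcoeff N k H = s k N * avg N (minor {..<k}) H" for N k H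
    unfolding rcoeff_eq_minor_sum minor_sum_def s_def sum_layer_eq_avg[OF equivariant_minor] by simp
  have s_lim: "s k \<longlonglongrightarrow> (- 1) ^ k * (1 / fact k)" for k
  proof -
    have "s k N = (- 1) ^ k * (of_nat (N choose k) / of_nat N ^ k)" for N
      unfolding s_def power_divide by simp
    moreover have "(\<lambda>N. (- 1) ^ k * (of_nat (N choose k) / of_nat N ^ k) :: complex) \<longlonglongrightarrow> (- 1) ^ k * (1 / fact k)"
      using binomial_over_power_limit[of k k] by (intro tendsto_mult tendsto_const) auto
    ultimately show ?thesis by presburger
  qed
  have "\<forall>k\<in>{1..M}. \<exists>G g. powr_majorized ?\<mu> p (\<lambda>N. rcoeff N k) (a k) G g"
  proof
    fix k assume k: "k \<in> {1..M}"
    show "\<exists>G g. powr_majorized ?\<mu> p (\<lambda>N. rcoeff N k) (a k) G g"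
    proof (rule powr_majorized_scaled_avg)
      show "minor {..<k} \<in> borel_measurable ?\<mu>" by (rule meas_law[OF measurable_minor])
      show "integrable ?\<mu> (\<lambda>H. cmod (minor {..<k} H) powr p)"
        using moments[OF k] by (simp add: minor_lessThan)
      show "s k \<longlonglongrightarrow> (- 1) ^ k * (1 / fact k)" by (rule s_lim)
    qed (simp_all add: \<open>p \<ge> 1\<close> rcoeff_avg a_meas meas_law a_def)
  qed
  then obtain G g where maj: "\<And>k. k \<in> {1..M} \<Longrightarrow> powr_majorized ?\<mu> p (\<lambda>N. rcoeff N k) (a k) (G k) (g k)"
    unfolding bchoice_iff by blast
  have Lp: "tendsto_Lp ?\<mu> p (\<lambda>N. rcoeff N k) (a k)" if "k \<in> {1..M}" for k
    using powr_majorized_tendsto_Lp[OF maj[OF that]] \<open>p \<ge> 1\<close> by simp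
  have lim: "AE H in ?\<mu>. (\<lambda>N. rcoeff N k H) \<longlonglongrightarrow> a k H" if "k \<in> {1..M}" for k
    using maj[OF that] by (simp add: powr_majorized_def)

  have mixed_moments: "(\<forall>N. integrable ?\<mu> (\<lambda>H. \<Prod>k = 1..M. rpow (cmod (rcoeff N k H)) (r k))) \<and>
        integrable ?\<mu> (\<lambda>H. \<Prod>k = 1..M. rpow (cmod (a k H)) (r k)) \<and>
        (\<lambda>N. \<integral>H. (\<Prod>k = 1..M. rpow (cmod (rcoeff N k H)) (r k)) \<partial>?\<mu>)
          \<longlonglongrightarrow> (\<integral>H. (\<Prod>k = 1..M. rpow (cmod (a k H)) (r k)) \<partial>?\<mu>)"
    if "\<forall>k\<in>{1..M}. r k \<ge> 0" "(\<Sum>k = 1..M. r k) = p" for r :: "nat \<Rightarrow> real"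
  proof -
    have r: "\<And>k. k \<in> {1..M} \<Longrightarrow> 0 \<le> r k" using that(1) by blast
    have "p > 0" using \<open>p \<ge> 1\<close> by simp
    note * = powr_majorized_prod_rpow[of "{1..M}" ?\<mu> p rcoeff, OF finite_atLeastAtMost maj r that(2) \<open>p > 0\<close>]
    show ?thesis using *(1,3) *(2) by blast
  qed

  have joint_moments:
    "(real (\<Sum>j = 1..l. r j) \<le> p \<longrightarrow>
        (\<forall>m\<in>{k 1..L}. integrable ?\<mu> (\<lambda>H. \<Prod>j = 1..l. rcoeff m (k j) H ^ r j))) \<and>
      ((\<forall>m\<in>{k 1..L}. integrable ?\<mu> (\<lambda>H. \<Prod>j = 1..l. rcoeff m (k j) H ^ r j)) \<longrightarrow>
        integrable ?\<mu> (\<lambda>H. \<Prod>j = 1..l. a (k j) H ^ r j) \<and>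
        (\<integral>H. (\<Prod>j = 1..l. a (k j) H ^ r j) \<partial>?\<mu>) =
          1 / fact L *
          (\<Sum>m = k 1..L. (- 1) ^ (m + L) * of_nat (L choose m) * of_nat m ^ L *
             (\<integral>H. (\<Prod>j = 1..l. rcoeff m (k j) H ^ r j) \<partial>?\<mu>)))"
    if l: "l \<ge> 1" and r: "\<forall>j\<in>{1..l}. r j \<ge> 1"
      and dec: "\<forall>i\<in>{1..l}. \<forall>j\<in>{1..l}. i < j \<longrightarrow> k i > k j"
      and k_range: "k 1 \<le> M" "k l \<ge> 1" and L: "L = (\<Sum>j = 1..l. r j * k j)"
    for l L :: nat and r k :: "nat \<Rightarrow> nat"
  proof -
    have k: "k j \<in> {1..M}" if "j \<in> {1..l}" for j
    proof -
      have "k j \<le> k 1" using dec that l by (cases "j = 1") (auto intro!: less_imp_le)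
      moreover have "k l \<le> k j" using dec that l by (cases "j = l") (auto intro!: less_imp_le)
      ultimately show ?thesis using k_range by auto
    qed
    define R where "R m H = (\<Prod>j = 1..l. rcoeff m (k j) H ^ r j)" for m H
    define A where "A H = (\<Prod>j = 1..l. a (k j) H ^ r j)" for H
    have integrable_R: "integrable ?\<mu> (R m)" if p: "real (\<Sum>j = 1..l. r j) \<le> p" for m
    proof (rule Bochner_Integration.integrable_bound)
      show "integrable ?\<mu> (\<lambda>H. 1 + (\<Sum>j = 1..l. cmod (rcoeff m (k j) H) powr p))"
      proof (intro Bochner_Integration.integrable_add Bochner_Integration.integrable_sum)
        fix j assume "j \<in> {1..l}"
        from Lp[OF k[OF this]] show "integrable ?\<mu> (\<lambda>H. cmod (rcoeff m (k j) H) powr p)"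
          by (simp add: tendsto_Lp_def Lp_fun_def)
      qed simp
      show "R m \<in> borel_measurable ?\<mu>"
        unfolding R_def using meas_law[OF measurable_rcoeff]
        by (intro borel_measurable_prod borel_measurable_power) auto
      show "AE H in ?\<mu>. norm (R m H) \<le> norm (1 + (\<Sum>j = 1..l. cmod (rcoeff m (k j) H) powr p))"
      proof (intro AE_I2)
        fix H
        have "norm (R m H) \<le> 1 + (\<Sum>j = 1..l. cmod (rcoeff m (k j) H) powr p)"
          using prod_power_le_sum_powr[of "{1..l}" "\<lambda>j. cmod (rcoeff m (k j) H)" r p] p
          by (simp add: R_def norm_power prod_norm[symmetric])
        then show "norm (R m H) \<le> norm (1 + (\<Sum>j = 1..l. cmod (rcoeff m (k j) H) powr p))" by simp
      qed
    qed
    have limit_moment: "integrable ?\<mu> A \<and> (\<integral>H. A H \<partial>?\<mu>) = 1 / fact L *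
          (\<Sum>m = k 1..L. (- 1) ^ (m + L) * of_nat (L choose m) * of_nat m ^ L * (\<integral>H. R m H \<partial>?\<mu>))"
      if int: "\<forall>m\<in>{k 1..L}. integrable ?\<mu> (R m)"
    proof -
            \<comment> \<open>\<open>F {..<m}\<close> undoes the rescaling of the coefficients; this is the source of the factor \<open>m ^ L\<close>.\<close>
define F where "F S H = (\<Prod>j = 1..l. minor_sum S (k j) H ^ r j)" for S H
      have F_R: "F {..<m} H = (- of_nat m) ^ L * R m H" for m H
      proof -
        have "F {..<m} H = (\<Prod>j = 1..l. (- of_nat m) ^ (r j * k j) * rcoeff m (k j) H ^ r j)"
          unfolding F_def
          by (intro prod.cong refl)
             (use k in \<open>simp add: minor_sum_lessThan_eq_rcoeff power_mult_distrib power_mult[symmetric] mult.commute\<close>)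
        then show ?thesis by (simp add: prod.distrib R_def L power_sum)
      qed
            \<comment> \<open>A corner smaller than \<open>k 1\<close> has no minors of that size, so the sum over \<open>m\<close> may start at \<open>k 1\<close>.\<close>
have R_0: "R m H = 0" if "m < k 1" for m H
      proof -
        have one: "1 \<in> {1..l}" using l by simp
        then have "r 1 \<ge> 1" using r by blast
        then have "rcoeff m (k 1) H ^ r 1 = 0" using rcoeff_eq_0[OF that] by simp
        then show ?thesis unfolding R_def using one by (intro prod_zero) blast+
      qed
      have F_equivariant: "equivariant F"
        unfolding equivariant_def F_def
      proof (intro allI impI, elim conjE)
        fix n :: nat and \<tau> S H assume "\<tau> permutes {..<n}" "S \<subseteq> {..<n}"
        note minor_sum_image[OF this]
        then show "(\<Prod>j = 1..l. minor_sum (\<tau> ` S) (k j) H ^ r j) =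
            (\<Prod>j = 1..l. minor_sum S (k j) (relabel \<tau> H) ^ r j)" by simp
      qed
      have F_degree: "subset_degree_le L (\<lambda>S. F S H)" for H
        unfolding F_def L minor_sum_def
        by (intro subset_degree_le_prod subset_degree_le_power subset_degree_le_layer) simp
      have int_F: "integrable ?\<mu> (F {..<m})" if "m \<le> L" for m
      proof (cases "m < k 1")
        case True
        then show ?thesis by (simp add: F_R[abs_def] R_0)
      next
        case False
        then show ?thesis using int that by (simp add: F_R[abs_def])
      qed
      obtain V where V: "integrable ?\<mu> V" "AE H in ?\<mu>. (\<lambda>N. F {..<N} H / of_nat N ^ L) \<longlonglongrightarrow> V H"
        "(\<integral>H. V H \<partial>?\<mu>) = 1 / fact L * (\<Sum>m\<le>L. (- 1) ^ (L - m) * of_nat (L choose m) * (\<integral>H. F {..<m} H \<partial>?\<mu>))"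
        using polynomial_statistic_converges[OF F_equivariant F_degree int_F] by blast
      have "AE H in ?\<mu>. \<forall>j\<in>{1..l}. (\<lambda>N. rcoeff N (k j) H) \<longlonglongrightarrow> a (k j) H"
        using lim[OF k] by (intro AE_finite_allI) auto
      then have A_V: "AE H in ?\<mu>. (- 1) ^ L * V H = A H"
        using V(2)
      proof eventually_elim
        case (elim H)
        have "(\<lambda>N. (- 1) ^ L * R N H) \<longlonglongrightarrow> (- 1) ^ L * A H"
          unfolding R_def A_def using elim(1) by (intro tendsto_mult tendsto_const tendsto_prod tendsto_power) auto
        moreover have "\<forall>\<^sub>F N in sequentially. F {..<N} H / of_nat N ^ L = (- 1) ^ L * R N H"
          using eventually_gt_at_top[of 0]
        proof eventually_elim
          case (elim N)
          have "(- of_nat N :: complex) ^ L = (- 1) ^ L * of_nat N ^ L" by (rule power_minus)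
          then show ?case using elim by (simp add: F_R)
        qed
        then have "(\<lambda>N. (- 1) ^ L * R N H) \<longlonglongrightarrow> V H"
          by (rule Lim_transform_eventually[OF elim(2)])
        ultimately have "V H = (- 1) ^ L * A H" by (rule LIMSEQ_unique[rotated])
        then show ?case by (simp add: mult.assoc[symmetric] power_mult_distrib[symmetric])
      qed
      have A_meas: "A \<in> borel_measurable ?\<mu>"
        unfolding A_def using meas_law[OF a_meas]
        by (intro borel_measurable_prod borel_measurable_power) auto
      have int_V: "integrable ?\<mu> (\<lambda>H. (- 1) ^ L * V H)" using V(1) by simp
      have int_A: "integrable ?\<mu> A"
        using integrable_cong_AE[OF borel_measurable_integrable[OF int_V] A_meas A_V] int_V by simp
      have A_eq: "(\<integral>H. A H \<partial>?\<mu>) = (- 1) ^ L * (\<integral>H. V H \<partial>?\<mu>)"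
        using integral_cong_AE[OF borel_measurable_integrable[OF int_V] A_meas A_V] by simp
      have sum_eq: "(- 1) ^ L * (\<Sum>m\<le>L. (- 1) ^ (L - m) * of_nat (L choose m) * (\<integral>H. F {..<m} H \<partial>?\<mu>)) =
          (\<Sum>m = k 1..L. (- 1) ^ (m + L) * of_nat (L choose m) * of_nat m ^ L * (\<integral>H. R m H \<partial>?\<mu>))"
        (is "?lhs = ?rhs")
      proof -
        have "?lhs = (\<Sum>m\<le>L. (- 1) ^ (m + L) * of_nat (L choose m) * of_nat m ^ L * (\<integral>H. R m H \<partial>?\<mu>))"
          unfolding sum_distrib_left
        proof (rule sum.cong[OF refl])
          fix m assume "m \<in> {..L}"
          then have m: "m \<le> L" by simp
          have "(\<integral>H. F {..<m} H \<partial>?\<mu>) = (- of_nat m) ^ L * (\<integral>H. R m H \<partial>?\<mu>)" by (simp add: F_R)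
          also have "(- of_nat m :: complex) ^ L = (- 1) ^ L * of_nat m ^ L" by (rule power_minus)
          finally have F: "(\<integral>H. F {..<m} H \<partial>?\<mu>) = (- 1) ^ L * of_nat m ^ L * (\<integral>H. R m H \<partial>?\<mu>)" .
                    \<comment> \<open>One sign relates \<open>A\<close> to \<open>V\<close>, one \<open>F\<close> to \<open>R\<close>, and one comes from the Moebius transform.\<close>
have "even (L + (L - m) + L + (m + L))" using m by presburger
          then have sign: "(- 1) ^ L * (- 1) ^ (L - m) * (- 1) ^ L = ((- 1) ^ (m + L) :: complex)"
            using m by (simp add: power_add[symmetric] uminus_power_if)
          show "(- 1) ^ L * ((- 1) ^ (L - m) * of_nat (L choose m) * (\<integral>H. F {..<m} H \<partial>?\<mu>)) =
              (- 1) ^ (m + L) * of_nat (L choose m) * of_nat m ^ L * (\<integral>H. R m H \<partial>?\<mu>)"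
            unfolding F sign[symmetric] by (simp only: mult_ac)
        qed
        also have "\<dots> = ?rhs"
        proof (rule sum.mono_neutral_right)
          show "\<forall>m\<in>{..L} - {k 1..L}. (- 1) ^ (m + L) * of_nat (L choose m) * of_nat m ^ L *
              (\<integral>H. R m H \<partial>?\<mu>) = 0"
          proof
            fix m assume "m \<in> {..L} - {k 1..L}"
            then have "R m = (\<lambda>H. 0)" using R_0 by auto
            then show "(- 1) ^ (m + L) * of_nat (L choose m) * of_nat m ^ L * (\<integral>H. R m H \<partial>?\<mu>) = 0"
              by simp
          qed
        qed auto
        finally show ?thesis .
      qed
      show ?thesis
        unfolding A_eq V(3) sum_eq[symmetric] using int_A by (simp only: mult.left_commute)
    qed
    show ?thesis
      using integrable_R limit_moment unfolding R_def A_def by blast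
  qed

  show ?thesis
  proof (rule exI[of _ a], rule conjI[OF _ conjI], goal_cases)
    case 1
    show ?case using a_meas Lp lim by blast
  next
    case 2
    show ?case by (intro allI impI, elim conjE, rule mixed_moments)
  next
    case 3
    show ?case by (intro allI impI, elim conjE, rule joint_moments)
  qed
qed

end
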